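(* Let $A\colon[0,+\infty)\to\mathcal{L}(\mathbb{R}^n)$ be of locally bounded variation and continuous from the left, such that $I-\Delta^{-}A(t)$ is invertible for all $t\in(0,+\infty)$ and $I+\Delta^{+}A(t)$ is invertible for all $t\ge0$. Let $U$ be the transition matrix of $\frac{dx}{d\tau}=D[A(t)x]$. Then the trivial solution of this equation is variationally asymptotically stable if and only if there exist constants $\alpha,K>0$ such that $\|U(t,s_0)\|\le Ke^{-\alpha(t-s_0)}$ for all $t\ge s_0\ge 0$.
   Context: Here $\Delta^{+}A(t)=A(t^+)-A(t)$, $\Delta^{-}A(t)=A(t)-A(t^-)$, and $\mathrm{var}_a^b$ denotes total variation on $[a,b]$. Integrals $\int_a^b \mathrm{d}[A(s)]x(s)$ are Perron–Stieltjes (Kurzweil–Stieltjes) integrals. A solution of $\frac{dx}{d\tau}=D[A(t)x]$ is a function $x$ with $x(b)-x(a)=\int_a^b\mathrm{d}[A(s)]x(s)$ for all $a,b$ in its interval of definition. The transition matrix $U$ is the unique matrix function on $[0,+\infty)^2$ with $U(t,s)=I+\int_s^t\mathrm{d}[A(r)]U(r,s)$; the unique solution with $x(s_0)=x_0$ is $U(t,s_0)x_0$, $t\ge s_0$. The trivial solution is variationally stable if for every $\varepsilon>0$ there is $\delta=\delta(\varepsilon)>0$ such that whenever $s_0\ge0$ and $y\colon[s_0,+\infty)\to\mathbb{R}^n$ is of locally bounded variation, left-continuous on $(s_0,+\infty)$, with $\|y(s_0)\|<\delta$ and $\sup_{t\ge s_0}\mathrm{var}_{s_0}^t\big(y(s)-\int_{s_0}^s\mathrm{d}[A(\xi)]y(\xi)\big)<\delta$,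 then $\|y(t)\|<\varepsilon$ for all $t\ge s_0$. It is variationally attracting if there exists $\delta_0>0$ and for every $\varepsilon>0$ there are $T=T(\varepsilon)\ge0$ and $\gamma=\gamma(\varepsilon)>0$ such that whenever $s_0\ge0$ and $y\colon[s_0,+\infty)\to\mathbb{R}^n$ is of locally bounded variation, left-continuous on $(s_0,+\infty)$, with $\|y(s_0)\|<\delta_0$ and $\sup_{t\ge s_0}\mathrm{var}_{s_0}^t\big(y(s)-\int_{s_0}^s\mathrm{d}[A(\xi)]y(\xi)\big)<\gamma$, then $\|y(t)\|<\varepsilon$ for all $t\ge s_0+T(\varepsilon)$. It is variationally asymptotically stable if it is both variationally stable and variationally attracting. *)

theory Defs
  imports "HOL-Analysis.Analysis"
begin

section \<open>Kurzweil--Stieltjes (Perron--Stieltjes) integral\<close>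

text \<open>Oriented Kurzweil--Stieltjes integral of f with respect to the integrator A,
  with the product of integrator increment and integrand given by pr
  (matrix-matrix or matrix-vector product). For a > b the integral is
  minus the integral from b to a.\<close>

definition KS_has_integral_ord ::
  "('a::ab_group_add \<Rightarrow> 'b \<Rightarrow> 'c::real_normed_vector) \<Rightarrow> (real \<Rightarrow> 'a) \<Rightarrow> (real \<Rightarrow> 'b)
     \<Rightarrow> 'c \<Rightarrow> real \<Rightarrow> real \<Rightarrow> bool" where
  "KS_has_integral_ord pr A f I a b \<longleftrightarrow>
     (\<forall>e>0. \<exists>\<gamma>. gauge \<gamma> \<and>
        (\<forall>D. D tagged_division_of {a..b} \<and> \<gamma> fine D \<longrightarrow>
           norm ((\<Sum>(t,K)\<in>D. pr (A (Sup K) - A (Inf K)) (f t)) - I) < e))"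

definition KS_has_integral ::
  "('a::ab_group_add \<Rightarrow> 'b \<Rightarrow> 'c::real_normed_vector) \<Rightarrow> (real \<Rightarrow> 'a) \<Rightarrow> (real \<Rightarrow> 'b)
     \<Rightarrow> 'c \<Rightarrow> real \<Rightarrow> real \<Rightarrow> bool" where
  "KS_has_integral pr A f I a b \<longleftrightarrow>
     (if a \<le> b then KS_has_integral_ord pr A f I a b
      else KS_has_integral_ord pr A f (- I) b a)"

definition KS_integral ::
  "('a::ab_group_add \<Rightarrow> 'b \<Rightarrow> 'c::real_normed_vector) \<Rightarrow> (real \<Rightarrow> 'a) \<Rightarrow> (real \<Rightarrow> 'b)
     \<Rightarrow> real \<Rightarrow> real \<Rightarrow> 'c" where
  "KS_integral pr A f a b = (THE I. KS_has_integral pr A f I a b)"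

section \<open>Total variation\<close>

definition total_variation :: "(real \<Rightarrow> 'a::real_normed_vector) \<Rightarrow> real \<Rightarrow> real \<Rightarrow> ereal" where
  "total_variation f a b =
     (SUP D \<in> {D. D division_of {a..b}}. ereal (\<Sum>K\<in>D. norm (f (Sup K) - f (Inf K))))"

definition locally_bv_on :: "(real \<Rightarrow> 'a::real_normed_vector) \<Rightarrow> real \<Rightarrow> bool" where
  "locally_bv_on f s \<longleftrightarrow> (\<forall>t\<ge>s. total_variation f s t < \<infinity>)"

section \<open>Generalized linear ODE dx/d\<tau> = D[A(t)x]\<close>

text \<open>Transition matrix: U(t,s) = I + \<integral>_s^t d[A(r)] U(r,s) for all t, s \<ge> 0.\<close>

definition is_transition_matrix ::
  "(real \<Rightarrow> real^'n^'n) \<Rightarrow> (real \<Rightarrow> real \<Rightarrow> real^'n^'n) \<Rightarrow> bool" where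
  "is_transition_matrix A U \<longleftrightarrow>
     (\<forall>t\<ge>0. \<forall>s\<ge>0. KS_has_integral (**) A (\<lambda>r. U r s) (U t s - mat 1) s t)"

definition var_stable :: "(real \<Rightarrow> real^'n^'n) \<Rightarrow> bool" where
  "var_stable A \<longleftrightarrow>
     (\<forall>\<epsilon>>0. \<exists>\<delta>>0. \<forall>s0\<ge>0. \<forall>y :: real \<Rightarrow> real^'n.
        locally_bv_on y s0 \<and> (\<forall>t>s0. continuous (at_left t) y) \<and>
        norm (y s0) < \<delta> \<and>
        (SUP t\<in>{s0..}. total_variation (\<lambda>s. y s - KS_integral (*v) A y s0 s) s0 t) < ereal \<delta>
        \<longrightarrow> (\<forall>t\<ge>s0. norm (y t) < \<epsilon>))"

definition var_attracting :: "(real \<Rightarrow> real^'n^'n) \<Rightarrow> bool" where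
  "var_attracting A \<longleftrightarrow>
     (\<exists>\<delta>0>0. \<forall>\<epsilon>>0. \<exists>T\<ge>0. \<exists>\<gamma>>0. \<forall>s0\<ge>0. \<forall>y :: real \<Rightarrow> real^'n.
        locally_bv_on y s0 \<and> (\<forall>t>s0. continuous (at_left t) y) \<and>
        norm (y s0) < \<delta>0 \<and>
        (SUP t\<in>{s0..}. total_variation (\<lambda>s. y s - KS_integral (*v) A y s0 s) s0 t) < ereal \<gamma>
        \<longrightarrow> (\<forall>t\<ge>s0 + T. norm (y t) < \<epsilon>))"

definition var_asymptotically_stable :: "(real \<Rightarrow> real^'n^'n) \<Rightarrow> bool" where
  "var_asymptotically_stable A \<longleftrightarrow> var_stable A \<and> var_attracting A"

text \<open>Operator norm of a matrix on (R^n, Euclidean norm).\<close>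

definition mat_norm :: "real^'n^'n \<Rightarrow> real" where
  "mat_norm M = onorm (\<lambda>x. M *v x)"

end

theory Submission
  imports Defs
begin

text \<open>
  Write Q(s) = y(s) - \<integral> d[A] y for the perturbation of a function y. If Q has total variation
  less than \<delta> and U(t,s) is bounded by K, then y(t) differs from U(t,s0) y(s0) by at most
  2 K \<delta>. Instead of a variation of constants formula, one follows the path s \<mapsto> U(t,s) y(s)
  from U(t,s0) y(s0) to y(t): for c < d such that A varies by at most 1/2 on the open interval (c,d),
  its increment U(t,d) (y(d) - U(d,c) y(c)) is bounded by 2 K times the variation of Q on [c,d], and
  finitely many such steps lead from s0 to t. Exponential decay of U therefore gives both stability
  and attraction. Conversely, the solutions U(t,s) x have a constant Q, so stability bounds U,
  attraction gives a T with norm at most 1/2 for all U(s+T,s), and the cocycle law turns this into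
  exponential decay.
\<close>

section \<open>Riemann--Stieltjes sums and the Kurzweil--Stieltjes integral\<close>

text \<open>The functions y tested in the two stability notions are arbitrary apart from bounded
  variation and left continuity, and \<open>KS_integral\<close> is a definite description. Before
  the variation of Q says anything about y, the integral has to be shown to exist; hence the
  existence theorem for functions of bounded variation that precedes the dynamics. The obstacle to a
  Gronwall estimate is the jumps of A: they need not be small, so no subdivision makes the variation
  of A small on closed intervals. It becomes small only on the open intervals between division
  points. This is why y is compared on each piece with a solution restarted at the left end c, so
  that the difference vanishes at c. The factor 2 is 1/(1 - 1/2), from absorbing a supremum with
  contraction factor 1/2.\<close>

lemma norm_matrix_vector_mult_le:
  fixes M :: "real^'n^'m"
  shows "norm (M *v x) \<le> norm M * norm x"
proof -
  \<comment> \<open>The norm of a matrix here is that of a vector of rows, the Frobenius norm, and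
    not \<open>mat_norm\<close>; Cauchy-Schwarz is applied to each row.\<close>
  have "norm (M *v x) = L2_set (\<lambda>i. \<bar>M $ i \<bullet> x\<bar>) UNIV"
    by (simp add: norm_vec_def matrix_vector_mul_component)
  also have "\<dots> \<le> L2_set (\<lambda>i. norm (M $ i) * norm x) UNIV"
    by (intro L2_set_mono) (auto simp: Cauchy_Schwarz_ineq2)
  also have "\<dots> = norm M * norm x"
    by (simp add: norm_vec_def[of M] L2_set_left_distrib)
  finally show ?thesis .
qed

lemma norm_triangle_lt_diff3:
  fixes p q r :: "'z::real_normed_vector"
  assumes "norm r < a" "norm p < b" "norm q < c"
  shows "norm (r - (p + q)) < a + (b + c)"
  using assms norm_triangle_ineq4[of r "p + q"] norm_triangle_ineq[of p q] by linarith

text \<open>Only matrix-vector products are treated; the matrix equation for U is reduced to them in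
  \<open>KS_has_integral_matrix_vector\<close>.\<close>

definition RS :: "(real \<Rightarrow> real^'n^'m) \<Rightarrow> (real \<Rightarrow> real^'n) \<Rightarrow> (real \<times> real set) set \<Rightarrow> real^'m" where
  "RS A f D = (\<Sum>(t,K)\<in>D. (A (Sup K) - A (Inf K)) *v f t)"

context
  fixes A :: "real \<Rightarrow> real^'n^'m" and f :: "real \<Rightarrow> real^'n"
begin

lemma KS_has_integral_RS:
  assumes "a \<le> b"
  shows "KS_has_integral (*v) A f I a b \<longleftrightarrow>
     (\<forall>e>0. \<exists>\<gamma>. gauge \<gamma> \<and> (\<forall>D. D tagged_division_of {a..b} \<and> \<gamma> fine D \<longrightarrow> norm (RS A f D - I) < e))"
  using assms by (simp add: KS_has_integral_def KS_has_integral_ord_def RS_def)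

lemma KS_has_integralD:
  assumes "KS_has_integral (*v) A f I a b" "a \<le> b" "e > 0"
  obtains \<gamma> where "gauge \<gamma>"
    "\<And>D. D tagged_division_of {a..b} \<Longrightarrow> \<gamma> fine D \<Longrightarrow> norm (RS A f D - I) < e"
  using assms(1,3) that unfolding KS_has_integral_RS[OF assms(2)] by metis

end

lemma tagged_division_real_element:
  assumes "D tagged_division_of {a..b::real}" "(x, K) \<in> D"
  obtains u v where "K = {u..v}" "a \<le> u" "u \<le> x" "x \<le> v" "v \<le> b"
proof -
  obtain u v where K: "K = {u..v}"
    using tagged_division_ofD(4)[OF assms] by auto
  have "x \<in> K" "K \<subseteq> {a..b}"
    using tagged_division_ofD(2,3)[OF assms] by auto
  then show ?thesis
    using that[of u v] K by auto
qed

context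
  fixes A :: "real \<Rightarrow> real^'n^'m" and f :: "real \<Rightarrow> real^'n"
begin

text \<open>Increments of F and H are additive over a division, so local errors add up to one
  increment of H. As H is arbitrary, it may jump at a point where the local error does not become
  small.\<close>

lemma RS_telescope:
  assumes D: "D tagged_division_of {a..b}" "\<gamma> fine D" and "a \<le> b"
    and loc: "\<And>u x v. \<lbrakk>a \<le> u; u \<le> x; x \<le> v; v \<le> b; {u..v} \<subseteq> \<gamma> x\<rbrakk>
      \<Longrightarrow> norm ((A v - A u) *v f x - (F v - F u)) \<le> H v - H u"
  shows "norm (RS A f D - (F b - F a)) \<le> (H b - H a :: real)"
proof -
  have "RS A f D - (F b - F a) = (\<Sum>(x,K)\<in>D. (A (Sup K) - A (Inf K)) *v f x - (F (Sup K) - F (Inf K)))"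
    unfolding RS_def additive_tagged_division_1[OF \<open>a \<le> b\<close> D(1), of F, symmetric]
    by (simp add: sum_subtractf case_prod_unfold)
  also have "norm \<dots> \<le> (\<Sum>(x,K)\<in>D. H (Sup K) - H (Inf K))"
  proof (rule sum_norm_le, clarify)
    fix x K assume xK: "(x, K) \<in> D"
    then obtain u v where "K = {u..v}" "a \<le> u" "u \<le> x" "x \<le> v" "v \<le> b"
      using tagged_division_real_element[OF D(1)] by metis
    moreover have "K \<subseteq> \<gamma> x"
      using D(2) xK by (auto simp: fine_def)
    ultimately show "norm ((A (Sup K) - A (Inf K)) *v f x - (F (Sup K) - F (Inf K))) \<le> H (Sup K) - H (Inf K)"
      using loc by auto
  qed
  also have "\<dots> = H b - H a"
    by (rule additive_tagged_division_1[OF \<open>a \<le> b\<close> D(1)])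
  finally show ?thesis .
qed

lemma tagged_division_append:
  assumes D: "D tagged_division_of {a..c}" "E tagged_division_of {c..b}" and "a \<le> c" "c \<le> (b::real)"
  shows "D \<union> E tagged_division_of {a..b}" "RS A f (D \<union> E) = RS A f D + RS A f E"
proof -
  have "interior {a..c} \<inter> interior {c..b} = {}"
    by auto
  from tagged_division_Un[OF D this] show "D \<union> E tagged_division_of {a..b}"
    using assms(3,4) by (simp add: ivl_disj_un_two_touch(4))
  \<comment> \<open>D and E may share a degenerate interval at c, which the union counts once; its
    term is zero.\<close>
  have "(A (Sup K) - A (Inf K)) *v f x = 0" if xK: "(x, K) \<in> D" "(x, K) \<in> E" for x K
  proof -
    obtain u v where 1: "K = {u..v}" "a \<le> u" "u \<le> x" "x \<le> v" "v \<le> c"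
      using tagged_division_real_element[OF D(1) xK(1)] by metis
    obtain u' v' where 2: "K = {u'..v'}" "c \<le> u'" "u' \<le> x" "x \<le> v'" "v' \<le> b"
      using tagged_division_real_element[OF D(2) xK(2)] by metis
    from 1 2 have "u = v"
      by auto
    with 1 show ?thesis by simp
  qed
  then show "RS A f (D \<union> E) = RS A f D + RS A f E"
    unfolding RS_def using D
    by (intro sum.union_inter_neutral) (auto dest: tagged_division_ofD(1))
qed

text \<open>A single gauge suffices, since it can be intersected with the one from the integral. A
  good choice of \<gamma> controls the tags near a bad point, where H may jump.\<close>

lemma KS_has_integral_bound:
  assumes I: "KS_has_integral (*v) A f I a b" and "a \<le> b" and "gauge \<gamma>"
    and loc: "\<And>u x v. \<lbrakk>a \<le> u; u \<le> x; x \<le> v; v \<le> b; {u..v} \<subseteq> \<gamma> x\<rbrakk>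
      \<Longrightarrow> norm ((A v - A u) *v f x) \<le> H v - H u"
  shows "norm I \<le> (H b - H a :: real)"
proof (rule field_le_epsilon)
  fix e :: real assume "e > 0"
  obtain \<gamma>' where \<gamma>': "gauge \<gamma>'"
      "\<And>D. D tagged_division_of {a..b} \<Longrightarrow> \<gamma>' fine D \<Longrightarrow> norm (RS A f D - I) < e"
    using KS_has_integralD[OF I \<open>a \<le> b\<close> \<open>e > 0\<close>] by metis
  obtain D where D: "D tagged_division_of {a..b}" "(\<lambda>x. \<gamma> x \<inter> \<gamma>' x) fine D"
    using fine_division_exists_real[OF gauge_Int[OF \<open>gauge \<gamma>\<close> \<open>gauge \<gamma>'\<close>]] by metis
  then have fine: "\<gamma> fine D" "\<gamma>' fine D"
    by (auto simp: fine_Int)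
  have "norm (RS A f D - (0 - 0)) \<le> H b - H a"
    using RS_telescope[OF D(1) fine(1) \<open>a \<le> b\<close>, where F = "\<lambda>_. 0" and H = H] loc by simp
  moreover have "norm (RS A f D - I) < e"
    using \<gamma>' D fine by blast
  ultimately show "norm I \<le> H b - H a + e"
    using norm_triangle_ineq4[of "RS A f D" "RS A f D - I"] by simp
qed

lemma KS_has_integral_unique:
  assumes "KS_has_integral (*v) A f I a b" "KS_has_integral (*v) A f J a b" "a \<le> b"
  shows "I = J"
proof (rule ccontr)
  assume "I \<noteq> J"
  then have e: "norm (I - J) / 2 > 0" by simp
  obtain \<gamma>1 where \<gamma>1: "gauge \<gamma>1"
      "\<And>D. D tagged_division_of {a..b} \<Longrightarrow> \<gamma>1 fine D \<Longrightarrow> norm (RS A f D - I) < norm (I - J) / 2"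
    using KS_has_integralD[OF assms(1,3) e] by metis
  obtain \<gamma>2 where \<gamma>2: "gauge \<gamma>2"
      "\<And>D. D tagged_division_of {a..b} \<Longrightarrow> \<gamma>2 fine D \<Longrightarrow> norm (RS A f D - J) < norm (I - J) / 2"
    using KS_has_integralD[OF assms(2,3) e] by metis
  obtain D where D: "D tagged_division_of {a..b}" "(\<lambda>x. \<gamma>1 x \<inter> \<gamma>2 x) fine D"
    using fine_division_exists_real[OF gauge_Int[OF \<open>gauge \<gamma>1\<close> \<open>gauge \<gamma>2\<close>]] by metis
  then have "norm (RS A f D - I) < norm (I - J) / 2" "norm (RS A f D - J) < norm (I - J) / 2"
    using \<gamma>1 \<gamma>2 by (auto simp: fine_Int)
  then show False
    using norm_triangle_ineq4[of "RS A f D - J" "RS A f D - I"] by simp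
qed

lemma KS_integral_eq:
  assumes "KS_has_integral (*v) A f I a b" "a \<le> b"
  shows "KS_integral (*v) A f a b = I"
  unfolding KS_integral_def
  by (intro the_equality assms(1) KS_has_integral_unique[OF _ assms])

text \<open>One fixed fine division of {a..c} completes every fine division of {c..b}, so the gauge
  for {a..b} also serves on {c..b}.\<close>

lemma KS_has_integral_remainder:
  assumes I: "KS_has_integral (*v) A f I a c" and J: "KS_has_integral (*v) A f J a b"
    and "a \<le> c" "c \<le> b"
  shows "KS_has_integral (*v) A f (J - I) c b"
  unfolding KS_has_integral_RS[OF \<open>c \<le> b\<close>]
proof (intro allI impI)
  fix e :: real assume "e > 0"
  then have e: "e / 2 > 0" by simp
  obtain \<gamma>1 where \<gamma>1: "gauge \<gamma>1"
      "\<And>D. D tagged_division_of {a..c} \<Longrightarrow> \<gamma>1 fine D \<Longrightarrow> norm (RS A f D - I) < e / 2"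
    using KS_has_integralD[OF I \<open>a \<le> c\<close> e] by metis
  obtain \<gamma>2 where \<gamma>2: "gauge \<gamma>2"
      "\<And>D. D tagged_division_of {a..b} \<Longrightarrow> \<gamma>2 fine D \<Longrightarrow> norm (RS A f D - J) < e / 2"
    using KS_has_integralD[OF J order.trans[OF \<open>a \<le> c\<close> \<open>c \<le> b\<close>] e] by metis
  obtain D where D: "D tagged_division_of {a..c}" "(\<lambda>x. \<gamma>1 x \<inter> \<gamma>2 x) fine D"
    using fine_division_exists_real[OF gauge_Int[OF \<open>gauge \<gamma>1\<close> \<open>gauge \<gamma>2\<close>]] by metis
  show "\<exists>\<gamma>. gauge \<gamma> \<and> (\<forall>D. D tagged_division_of {c..b} \<and> \<gamma> fine D \<longrightarrow> norm (RS A f D - (J - I)) < e)"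
  proof (intro exI[of _ \<gamma>2] conjI allI impI \<gamma>2(1))
    fix E assume E: "E tagged_division_of {c..b} \<and> \<gamma>2 fine E"
    then have "\<gamma>2 fine (D \<union> E)"
      using D by (intro fine_Un) (auto simp: fine_Int)
    then have "norm (RS A f (D \<union> E) - J) < e / 2"
      using \<gamma>2(2) tagged_division_append(1)[OF D(1) _ assms(3,4)] E by auto
    moreover have "norm (RS A f D - I) < e / 2"
      using D \<gamma>1 by (auto simp: fine_Int)
    moreover have "RS A f (D \<union> E) = RS A f D + RS A f E"
      using tagged_division_append(2)[OF D(1) _ assms(3,4)] E by auto
    ultimately show "norm (RS A f E - (J - I)) < e"
      using norm_triangle_ineq4[of "RS A f (D \<union> E) - J" "RS A f D - I"] by (simp add: algebra_simps)
  qed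
qed

text \<open>The Saks-Henstock lemma for a single tagged interval: no splitting of tagged divisions is
  needed, since the interval can be completed to a division of the whole range.\<close>

lemma KS_solution_local:
  assumes sol: "\<And>t. a \<le> t \<Longrightarrow> t \<le> b \<Longrightarrow> KS_has_integral (*v) A f (F t - F a) a t"
    and "a \<le> b" "e > 0"
  obtains \<gamma> where "gauge \<gamma>"
    "\<And>u x v. \<lbrakk>a \<le> u; u \<le> x; x \<le> v; v \<le> b; {u..v} \<subseteq> \<gamma> x\<rbrakk>
      \<Longrightarrow> norm ((A v - A u) *v f x - (F v - F u)) < e"
proof -
  have e3: "e / 3 > 0" using \<open>e > 0\<close> by simp
  obtain \<gamma> where \<gamma>: "gauge \<gamma>"
      "\<And>D. D tagged_division_of {a..b} \<Longrightarrow> \<gamma> fine D \<Longrightarrow> norm (RS A f D - (F b - F a)) < e / 3"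
    using KS_has_integralD[OF sol[OF \<open>a \<le> b\<close> order.refl] \<open>a \<le> b\<close> e3] by metis
  show thesis
  proof (rule that[OF \<gamma>(1)])
    fix u x v assume uxv: "a \<le> u" "u \<le> x" "x \<le> v" "v \<le> b" "{u..v} \<subseteq> \<gamma> x"
    have "KS_has_integral (*v) A f (F u - F a) a u"
      using sol uxv by auto
    \<comment> \<open>The gauges \<open>\<gamma>1\<close> and \<open>\<gamma>2\<close> depend on u
      and v and serve only to choose the completing divisions; the returned \<open>\<gamma>\<close>
      is fixed beforehand.\<close>
    then obtain \<gamma>1 where \<gamma>1: "gauge \<gamma>1"
      "\<And>D. D tagged_division_of {a..u} \<Longrightarrow> \<gamma>1 fine D \<Longrightarrow> norm (RS A f D - (F u - F a)) < e / 3"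
      using KS_has_integralD[OF _ _ e3] uxv by metis
    have "KS_has_integral (*v) A f ((F b - F a) - (F v - F a)) v b"
      using uxv by (intro KS_has_integral_remainder[OF sol[of v] sol[of b]]) auto
    then have "KS_has_integral (*v) A f (F b - F v) v b"
      by simp
    then obtain \<gamma>2 where \<gamma>2: "gauge \<gamma>2"
      "\<And>D. D tagged_division_of {v..b} \<Longrightarrow> \<gamma>2 fine D \<Longrightarrow> norm (RS A f D - (F b - F v)) < e / 3"
      using KS_has_integralD[OF _ _ e3] uxv by metis
    obtain D where D: "D tagged_division_of {a..u}" "(\<lambda>x. \<gamma> x \<inter> \<gamma>1 x) fine D"
      using fine_division_exists_real[OF gauge_Int[OF \<open>gauge \<gamma>\<close> \<open>gauge \<gamma>1\<close>]] by metis
    obtain E where E: "E tagged_division_of {v..b}" "(\<lambda>x. \<gamma> x \<inter> \<gamma>2 x) fine E"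
      using fine_division_exists_real[OF gauge_Int[OF \<open>gauge \<gamma>\<close> \<open>gauge \<gamma>2\<close>]] by metis
    have S: "{(x, {u..v})} tagged_division_of {u..v}"
      using uxv by (intro tagged_division_of_self_real) auto
    note DS = tagged_division_append[OF D(1) S \<open>a \<le> u\<close> order.trans[OF \<open>u \<le> x\<close> \<open>x \<le> v\<close>]]
    have "a \<le> v" using uxv by simp
    note DSE = tagged_division_append[OF DS(1) E(1) this \<open>v \<le> b\<close>]
    have "\<gamma> fine (D \<union> {(x, {u..v})} \<union> E)"
      using D E uxv by (intro fine_Un) (auto simp: fine_Int fine_def)
    from \<gamma>(2)[OF DSE(1) this]
    have "norm (RS A f D + (A v - A u) *v f x + RS A f E - (F b - F a)) < e / 3"
      using uxv unfolding DSE(2) DS(2) by (simp add: RS_def)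
    moreover have "norm (RS A f D - (F u - F a)) < e / 3" "norm (RS A f E - (F b - F v)) < e / 3"
      using \<gamma>1 \<gamma>2 D E by (auto simp: fine_Int)
    moreover have "(A v - A u) *v f x - (F v - F u) =
       (RS A f D + (A v - A u) *v f x + RS A f E - (F b - F a))
        - ((RS A f D - (F u - F a)) + (RS A f E - (F b - F v)))"
      by (simp add: algebra_simps)
    ultimately have "norm ((A v - A u) *v f x - (F v - F u)) < e / 3 + (e / 3 + e / 3)"
      by (simp only: norm_triangle_lt_diff3)
    then show "norm ((A v - A u) *v f x - (F v - F u)) < e"
      by simp
  qed
qed

end

lemma RS_diff:
  fixes A :: "real \<Rightarrow> real^'n^'m" and f g :: "real \<Rightarrow> real^'n"
  shows "RS A (\<lambda>t. f t - g t) D = RS A f D - RS A g D"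
  by (simp add: RS_def sum_subtractf case_prod_unfold matrix_vector_mult_diff_distrib)

lemma KS_has_integral_diff:
  fixes A :: "real \<Rightarrow> real^'n^'m" and f g :: "real \<Rightarrow> real^'n"
  assumes I: "KS_has_integral (*v) A f I a b" and J: "KS_has_integral (*v) A g J a b" and "a \<le> b"
  shows "KS_has_integral (*v) A (\<lambda>t. f t - g t) (I - J) a b"
  unfolding KS_has_integral_RS[OF \<open>a \<le> b\<close>]
proof (intro allI impI)
  fix e :: real assume "e > 0"
  then have e: "e / 2 > 0" by simp
  obtain \<gamma>1 where \<gamma>1: "gauge \<gamma>1"
      "\<And>D. D tagged_division_of {a..b} \<Longrightarrow> \<gamma>1 fine D \<Longrightarrow> norm (RS A f D - I) < e / 2"
    using KS_has_integralD[OF I \<open>a \<le> b\<close> e] by metis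
  obtain \<gamma>2 where \<gamma>2: "gauge \<gamma>2"
      "\<And>D. D tagged_division_of {a..b} \<Longrightarrow> \<gamma>2 fine D \<Longrightarrow> norm (RS A g D - J) < e / 2"
    using KS_has_integralD[OF J \<open>a \<le> b\<close> e] by metis
  show "\<exists>\<gamma>. gauge \<gamma> \<and> (\<forall>D. D tagged_division_of {a..b} \<and> \<gamma> fine D \<longrightarrow>
      norm (RS A (\<lambda>t. f t - g t) D - (I - J)) < e)"
  proof (intro exI[of _ "\<lambda>x. \<gamma>1 x \<inter> \<gamma>2 x"] conjI allI impI gauge_Int \<gamma>1(1) \<gamma>2(1))
    fix D assume "D tagged_division_of {a..b} \<and> (\<lambda>x. \<gamma>1 x \<inter> \<gamma>2 x) fine D"
    then have "norm (RS A f D - I) < e / 2" "norm (RS A g D - J) < e / 2"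
      using \<gamma>1(2) \<gamma>2(2) by (auto simp: fine_Int)
    then show "norm (RS A (\<lambda>t. f t - g t) D - (I - J)) < e"
      using norm_triangle_ineq4[of "RS A f D - I" "RS A g D - J"]
      by (simp add: RS_diff algebra_simps)
  qed
qed

lemma sum_matrix_vector_mult: "(\<Sum>i\<in>S. M i) *v x = (\<Sum>i\<in>S. M i *v x)"
  by (induction S rule: infinite_finite_induct) (auto simp: matrix_vector_mult_add_rdistrib)

text \<open>Multiplication by x is linear and bounded and passes through the sums by associativity.
  This turns the columns of U into solutions.\<close>

lemma KS_has_integral_matrix_vector:
  fixes A :: "real \<Rightarrow> real^'n^'m" and X :: "real \<Rightarrow> real^'k^'n"
  assumes I: "KS_has_integral (**) A X I a b" and "a \<le> b"
  shows "KS_has_integral (*v) A (\<lambda>t. X t *v x) (I *v x) a b"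
  unfolding KS_has_integral_RS[OF \<open>a \<le> b\<close>]
proof (intro allI impI)
  fix e :: real assume "e > 0"
  define e' where "e' = e / (norm x + 1)"
  have "norm x + 1 > 0" by (simp add: add_nonneg_pos)
  then have e': "e' > 0" "e' * norm x < e"
    using \<open>e > 0\<close> by (simp_all add: e'_def field_simps)
  have "\<forall>e>0. \<exists>\<gamma>. gauge \<gamma> \<and> (\<forall>D. D tagged_division_of {a..b} \<and> \<gamma> fine D \<longrightarrow>
      norm ((\<Sum>(t,K)\<in>D. (A (Sup K) - A (Inf K)) ** X t) - I) < e)"
    using I \<open>a \<le> b\<close> by (simp add: KS_has_integral_def KS_has_integral_ord_def)
  from this[rule_format, OF e'(1)] obtain \<gamma> where \<gamma>: "gauge \<gamma>"
    "\<And>D. D tagged_division_of {a..b} \<and> \<gamma> fine D \<Longrightarrow>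
      norm ((\<Sum>(t,K)\<in>D. (A (Sup K) - A (Inf K)) ** X t) - I) < e'"
    by blast
  show "\<exists>\<gamma>. gauge \<gamma> \<and> (\<forall>D. D tagged_division_of {a..b} \<and> \<gamma> fine D \<longrightarrow>
      norm (RS A (\<lambda>t. X t *v x) D - I *v x) < e)"
  proof (intro exI[of _ \<gamma>] conjI allI impI \<gamma>(1))
    fix D assume D: "D tagged_division_of {a..b} \<and> \<gamma> fine D"
    have "RS A (\<lambda>t. X t *v x) D - I *v x = ((\<Sum>(t,K)\<in>D. (A (Sup K) - A (Inf K)) ** X t) - I) *v x"
      by (simp add: RS_def case_prod_unfold matrix_vector_mult_diff_rdistrib[of _ I]
          sum_matrix_vector_mult matrix_vector_mul_assoc)
    also have "norm \<dots> \<le> norm ((\<Sum>(t,K)\<in>D. (A (Sup K) - A (Inf K)) ** X t) - I) * norm x"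
      by (rule norm_matrix_vector_mult_le)
    also have "\<dots> \<le> e' * norm x"
      by (intro mult_right_mono less_imp_le[OF \<gamma>(2)[OF D]]) simp
    also have "\<dots> < e" by (rule e')
    finally show "norm (RS A (\<lambda>t. X t *v x) D - I *v x) < e" .
  qed
qed

lemma gauge_UNIV: "gauge (\<lambda>x. UNIV)"
  by (simp add: gauge_def)

text \<open>All intervals in a division of {a..a} are degenerate. It supplies U(s,s) = I, which the
  transition equation states only implicitly, and Q(s0) = y(s0).\<close>

lemma KS_has_integral_refl_eq_0:
  fixes A :: "real \<Rightarrow> real^'n^'m" and f :: "real \<Rightarrow> real^'n"
  assumes "KS_has_integral (*v) A f I a a"
  shows "I = 0"
proof -
  have "norm I \<le> 0 - 0"
  proof (rule KS_has_integral_bound[OF assms order.refl gauge_UNIV, of "\<lambda>_. 0"])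
    fix u x v assume "a \<le> u" "u \<le> x" "x \<le> v" "v \<le> a"
    then have "u = v" by linarith
    then show "norm ((A v - A u) *v f x) \<le> 0 - 0" by simp
  qed
  then show ?thesis by simp
qed

section \<open>Existence of the integral for functions of bounded variation\<close>

text \<open>The strict inequality p < u leaves out a jump at p. Beyond p, V lies between its right
  limit, an infimum, and a value V(q) close to it.\<close>

lemma mono_small_variation_right:
  fixes V :: "real \<Rightarrow> real"
  assumes "mono V" "e > 0"
  obtains d where "d > 0" "\<And>u v. \<lbrakk>p < u; u \<le> v; v < p + d\<rbrakk> \<Longrightarrow> V v - V u \<le> e"
proof -
  have bdd: "bdd_below (V ` {p<..})"
    using monoD[OF \<open>mono V\<close>, of p] by (intro bdd_belowI2[of _ "V p"]) auto
  have "Inf (V ` {p<..}) < Inf (V ` {p<..}) + e"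
    using \<open>e > 0\<close> by simp
  then obtain q where q: "q > p" "V q < Inf (V ` {p<..}) + e"
    using cInf_lessD[of "V ` {p<..}"] that
    by (metis (no_types, lifting) empty_iff greaterThan_iff gt_ex imageE image_eqI)
  show thesis
  proof (rule that[of "q - p"])
    fix u v assume uv: "p < u" "u \<le> v" "v < p + (q - p)"
    have "V v \<le> V q" "Inf (V ` {p<..}) \<le> V u"
      using uv monoD[OF \<open>mono V\<close>, of v q] cInf_lower[OF _ bdd, of "V u"] by auto
    then show "V v - V u \<le> e"
      using q by linarith
  qed (use q in simp)
qed

lemma mono_small_variation_left:
  fixes V :: "real \<Rightarrow> real"
  assumes "mono V" "e > 0"
  obtains d where "d > 0" "\<And>u v. \<lbrakk>p - d < u; u \<le> v; v < p\<rbrakk> \<Longrightarrow> V v - V u \<le> e"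
proof -
  have "mono (\<lambda>t. - V (- t))"
    using \<open>mono V\<close> by (auto simp: mono_def)
  then obtain d where d: "d > 0"
    "\<And>u v. \<lbrakk>- p < u; u \<le> v; v < - p + d\<rbrakk> \<Longrightarrow> - V (- v) - - V (- u) \<le> e"
    using mono_small_variation_right[OF _ \<open>e > 0\<close>, of "\<lambda>t. - V (- t)" "- p"] by metis
  show thesis
  proof (rule that[OF d(1)])
    fix u v assume "p - d < u" "u \<le> v" "v < p"
    then show "V v - V u \<le> e"
      using d(2)[of "- v" "- u"] by simp
  qed
qed

text \<open>The candidate value I may depend on the error e. Two candidates are compared on a
  division fine for both gauges, so they form a Cauchy sequence, whose limit is the
  integral.\<close>

lemma KS_integrable_Cauchy:
  assumes approx: "\<And>e. e > 0 \<Longrightarrow> \<exists>I \<gamma>. gauge \<gamma> \<and>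
      (\<forall>D. D tagged_division_of {a..b} \<longrightarrow> \<gamma> fine D \<longrightarrow> norm (RS A f D - I) \<le> e)"
    and "a \<le> b"
  shows "\<exists>I. KS_has_integral (*v) A f I a b"
proof -
  have "\<forall>n. \<exists>I \<gamma>. gauge \<gamma> \<and>
      (\<forall>D. D tagged_division_of {a..b} \<longrightarrow> \<gamma> fine D \<longrightarrow> norm (RS A f D - I) \<le> inverse (real (Suc n)))"
    using approx by simp
  then obtain I \<gamma> where \<gamma>: "\<And>n. gauge (\<gamma> n)"
    and I: "\<And>n D. D tagged_division_of {a..b} \<Longrightarrow> \<gamma> n fine D
        \<Longrightarrow> norm (RS A f D - I n) \<le> inverse (real (Suc n))"
    by metis
  have II: "norm (I m - I n) \<le> inverse (real (Suc m)) + inverse (real (Suc n))" for m n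
  proof -
    obtain D where D: "D tagged_division_of {a..b}" "(\<lambda>x. \<gamma> m x \<inter> \<gamma> n x) fine D"
      using fine_division_exists_real[OF gauge_Int[OF \<gamma>[of m] \<gamma>[of n]]] by metis
    then have "norm (RS A f D - I m) \<le> inverse (real (Suc m))" "norm (RS A f D - I n) \<le> inverse (real (Suc n))"
      using I by (auto simp: fine_Int)
    then show ?thesis
      using norm_triangle_ineq4[of "RS A f D - I n" "RS A f D - I m"] by simp
  qed
  have "Cauchy I"
  proof (rule CauchyI)
    fix e :: real assume "e > 0"
    then obtain N where N: "inverse (real (Suc N)) < e / 2"
      using reals_Archimedean[of "e / 2"] by auto
    have "norm (I m - I n) < e" if "m \<ge> N" "n \<ge> N" for m n
    proof -
      have "inverse (real (Suc m)) \<le> inverse (real (Suc N))" "inverse (real (Suc n)) \<le> inverse (real (Suc N))"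
        using that by (auto intro!: le_imp_inverse_le)
      then show ?thesis
        using II[of m n] N by linarith
    qed
    then show "\<exists>M. \<forall>m\<ge>M. \<forall>n\<ge>M. norm (I m - I n) < e" by blast
  qed
  then obtain L where L: "I \<longlonglongrightarrow> L"
    using Cauchy_convergent_iff convergent_def by blast
  have IL: "norm (I m - L) \<le> inverse (real (Suc m))" for m
  proof (rule tendsto_le[OF trivial_limit_sequentially])
    show "(\<lambda>n. norm (I m - I n)) \<longlonglongrightarrow> norm (I m - L)"
      by (intro tendsto_intros L)
    show "(\<lambda>n. inverse (real (Suc m)) + inverse (real (Suc n))) \<longlonglongrightarrow> inverse (real (Suc m))"
      using tendsto_add[OF tendsto_const LIMSEQ_inverse_real_of_nat, of "inverse (real (Suc m))"] by simp
    show "\<forall>\<^sub>F n in sequentially. norm (I m - I n) \<le> inverse (real (Suc m)) + inverse (real (Suc n))"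
      using II by simp
  qed
  have "\<exists>\<gamma>. gauge \<gamma> \<and> (\<forall>D. D tagged_division_of {a..b} \<and> \<gamma> fine D \<longrightarrow> norm (RS A f D - L) < e)"
    if "e > 0" for e
  proof -
    obtain N where N: "inverse (real (Suc N)) < e / 2"
      using reals_Archimedean[of "e / 2"] \<open>e > 0\<close> by auto
    have "norm (RS A f D - L) < e" if D: "D tagged_division_of {a..b}" "\<gamma> N fine D" for D
    proof -
      have "norm (RS A f D - L) \<le> norm (RS A f D - I N) + norm (I N - L)"
        by (metis diff_add_cancel add_diff_eq norm_triangle_ineq)
      then show ?thesis
        using I[OF D] IL[of N] N by linarith
    qed
    then show ?thesis using \<gamma> by blast
  qed
  then show ?thesis
    unfolding KS_has_integral_RS[OF \<open>a \<le> b\<close>] by blast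
qed

text \<open>Here F is an indefinite integral of f up to an error counted by H, and H grows at most as
  much as the budget B. Such pairs (F, H) can be glued at an endpoint m, because the gauge can force
  every interval around m to have the tag m and hence to split there.\<close>

definition RS_approximable ::
  "(real \<Rightarrow> real^'n^'m) \<Rightarrow> (real \<Rightarrow> real^'n) \<Rightarrow> (real \<Rightarrow> real) \<Rightarrow> real \<Rightarrow> real \<Rightarrow> bool" where
  "RS_approximable A f B c d \<longleftrightarrow> (\<exists>F (H :: real \<Rightarrow> real) \<gamma>. gauge \<gamma> \<and>
     (\<forall>u x v. c \<le> u \<and> u \<le> x \<and> x \<le> v \<and> v \<le> d \<and> {u..v} \<subseteq> \<gamma> x \<longrightarrow>
        norm ((A v - A u) *v f x - (F v - F u)) \<le> H v - H u) \<and> H d - H c \<le> B d - B c)"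

lemma RS_approximable_trans:
  assumes "RS_approximable A f B c m" "RS_approximable A f B m d" "c \<le> m" "m \<le> d"
  shows "RS_approximable A f B c d"
proof -
  obtain F1 H1 \<gamma>1 where 1: "gauge \<gamma>1"
      "\<And>u x v. \<lbrakk>c \<le> u; u \<le> x; x \<le> v; v \<le> m; {u..v} \<subseteq> \<gamma>1 x\<rbrakk>
        \<Longrightarrow> norm ((A v - A u) *v f x - (F1 v - F1 u)) \<le> H1 v - H1 u" "H1 m - H1 c \<le> B m - B c"
    using assms(1) unfolding RS_approximable_def by metis
  obtain F2 H2 \<gamma>2 where 2: "gauge \<gamma>2"
      "\<And>u x v. \<lbrakk>m \<le> u; u \<le> x; x \<le> v; v \<le> d; {u..v} \<subseteq> \<gamma>2 x\<rbrakk>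
        \<Longrightarrow> norm ((A v - A u) *v f x - (F2 v - F2 u)) \<le> H2 v - H2 u" "H2 d - H2 m \<le> B d - B m"
    using assms(2) unfolding RS_approximable_def by metis
  define F where "F t = (if t \<le> m then F1 t else F1 m + (F2 t - F2 m))" for t
  define H where "H t = (if t \<le> m then H1 t else H1 m + (H2 t - H2 m))" for t
  define \<gamma> where "\<gamma> x = \<gamma>1 x \<inter> \<gamma>2 x \<inter> (if x < m then {..<m} else if x = m then UNIV else {m<..})" for x
  have F: "F t = F1 t" "H t = H1 t" if "t \<le> m" for t
    using that by (auto simp: F_def H_def)
  have F': "F t = F1 m + (F2 t - F2 m)" "H t = H1 m + (H2 t - H2 m)" if "t \<ge> m" for t
    using that by (auto simp: F_def H_def)
  have "norm ((A v - A u) *v f x - (F v - F u)) \<le> H v - H u"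
    if uxv: "c \<le> u" "u \<le> x" "x \<le> v" "v \<le> d" "{u..v} \<subseteq> \<gamma> x" for u x v
  proof -
    consider "v \<le> m" | "m \<le> u" | "u < m" "m < v" by linarith
    then show ?thesis
    proof cases
      assume "v \<le> m"
      then show ?thesis
        using 1(2)[of u x v] uxv by (simp add: F \<gamma>_def)
    next
      assume "m \<le> u"
      then show ?thesis
        using 2(2)[of u x v] uxv by (simp add: F' \<gamma>_def)
    next
      assume um: "u < m" "m < v"
      then have "m \<in> \<gamma> x" using uxv by auto
      then have x: "x = m"
        by (auto simp: \<gamma>_def split: if_splits)
      have "{u..m} \<subseteq> {u..v}" "{m..v} \<subseteq> {u..v}" using um by auto
      then have sub: "{u..m} \<subseteq> \<gamma>1 x" "{m..v} \<subseteq> \<gamma>2 x"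
        using uxv(5) by (auto simp: \<gamma>_def)
      have "norm ((A m - A u) *v f x - (F1 m - F1 u)) \<le> H1 m - H1 u"
        using sub uxv um x by (intro 1(2)) auto
      moreover have "norm ((A v - A m) *v f x - (F2 v - F2 m)) \<le> H2 v - H2 m"
        using sub uxv um x by (intro 2(2)) auto
      moreover have "(A v - A u) *v f x - (F v - F u) =
          ((A m - A u) *v f x - (F1 m - F1 u)) + ((A v - A m) *v f x - (F2 v - F2 m))"
        using um by (simp add: F F' matrix_vector_mult_diff_rdistrib)
      moreover have "H v - H u = (H1 m - H1 u) + (H2 v - H2 m)"
        using um by (simp add: F F')
      ultimately show ?thesis
        by (simp add: norm_triangle_mono)
    qed
  qed
  moreover have "gauge \<gamma>"
    using 1(1) 2(1) by (auto simp: gauge_def \<gamma>_def intro!: open_Int)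
  moreover have "H d - H c \<le> B d - B c"
    using 1(3) 2(3) assms(3,4) by (simp add: F F')
  ultimately show ?thesis
    unfolding RS_approximable_def by metis
qed

text \<open>With f nearly constant up to and including p, \<open>A t *v f p\<close> is an
  approximate indefinite integral, and its error is at most e times the variation of A.\<close>

lemma RS_approximable_left:
  assumes A: "\<And>u v. \<lbrakk>c \<le> u; u \<le> v; v \<le> p\<rbrakk> \<Longrightarrow> norm (A v - A u) \<le> V v - V u"
    and f: "\<And>x. \<lbrakk>c \<le> x; x \<le> p\<rbrakk> \<Longrightarrow> norm (f x - f p) \<le> e" and "c \<le> p" "0 < e"
  shows "RS_approximable A f (\<lambda>t. e * (V t + t)) c p"
proof -
  have "norm ((A v - A u) *v f x - (A v *v f p - A u *v f p)) \<le> e * V v - e * V u"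
    if "c \<le> u" "u \<le> x" "x \<le> v" "v \<le> p" for u x v
  proof -
    have "(A v - A u) *v f x - (A v *v f p - A u *v f p) = (A v - A u) *v (f x - f p)"
      by (simp add: matrix_vector_mult_diff_rdistrib matrix_vector_mult_diff_distrib)
    also have "norm \<dots> \<le> norm (A v - A u) * norm (f x - f p)"
      by (rule norm_matrix_vector_mult_le)
    also have "\<dots> \<le> (V v - V u) * e"
      using that A[of u v] f[of x] norm_ge_zero[of "A v - A u"] \<open>0 < e\<close>
      by (intro mult_mono norm_ge_zero) linarith+
    finally show ?thesis by (simp add: algebra_simps)
  qed
  moreover have "gauge (\<lambda>x::real. ball x 1)"
    by (rule gauge_ball) simp
  moreover have "e * V p - e * V c \<le> e * (V p + p) - e * (V c + c)"
    using \<open>c \<le> p\<close> \<open>0 < e\<close> by (simp add: algebra_simps)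
  ultimately show ?thesis
    unfolding RS_approximable_def
    by (intro exI[of _ "\<lambda>t. A t *v f p"] exI[of _ "\<lambda>t. e * V t"] exI[of _ "\<lambda>x. ball x 1"] conjI) auto
qed

text \<open>Here f may jump at p, so it is compared with f(d) on the half-open interval only. An
  interval with tag p needs separate treatment, and the summand t of the budget pays for it.\<close>

lemma RS_approximable_right:
  assumes A: "\<And>u v. \<lbrakk>p \<le> u; u \<le> v; v \<le> d\<rbrakk> \<Longrightarrow> norm (A v - A u) \<le> V v - V u" and "mono V"
    and f: "\<And>x. \<lbrakk>p < x; x \<le> d\<rbrakk> \<Longrightarrow> norm (f x - f d) \<le> e" and "p < d" "0 < e"
  shows "RS_approximable A f (\<lambda>t. e * (V t + t)) p d"
proof -
  \<comment> \<open>\<open>\<eta>\<close> is the growth of e * t on {p..d}. H spends it in a single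
    jump just after p, and k is the oscillation of A beyond p that keeps the error at tag p below
    \<open>\<eta>\<close>.\<close>
  define \<eta> where "\<eta> = e * (d - p)"
  define k where "k = \<eta> / (norm (f p - f d) + 1)"
  have "\<eta> > 0" "k > 0"
    using assms by (auto simp: \<eta>_def k_def intro!: divide_pos_pos add_nonneg_pos)
  have k: "k * norm (f p - f d) \<le> \<eta>"
  proof -
    have "norm (f p - f d) + 1 > 0"
      by (simp add: add_nonneg_pos)
    then show ?thesis
      using \<open>\<eta> > 0\<close> by (simp add: k_def pos_divide_le_eq algebra_simps)
  qed
  obtain r where r: "r > 0" "\<And>u v. \<lbrakk>p < u; u \<le> v; v < p + r\<rbrakk> \<Longrightarrow> V v - V u \<le> k"
    using mono_small_variation_right[OF \<open>mono V\<close> \<open>k > 0\<close>] by metis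
  define q where "q = min d (p + r / 2)"
  have q: "p < q" "q \<le> d" "q < p + r"
    using r \<open>p < d\<close> by (auto simp: q_def)
  txt \<open>The value of F at p absorbs the jump of A at p without mentioning the limit A(p+):
    the point q is so close to p that A(q) can replace it.\<close>
  define F where "F t = (if t \<le> p then A q *v f d - (A q - A p) *v f p else A t *v f d)" for t
  define H where "H t = e * V t + (if t \<le> p then 0 else \<eta>)" for t
  define \<gamma> where "\<gamma> x = (if x \<le> p then {..<q} else {p<..})" for x
  have "norm ((A v - A u) *v f x - (F v - F u)) \<le> H v - H u"
    if uxv: "p \<le> u" "u \<le> x" "x \<le> v" "v \<le> d" "{u..v} \<subseteq> \<gamma> x" for u x v
  proof -
    consider "v = p" | "x = p" "p < v" | "p < x" using uxv by linarith
    then show ?thesis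
    proof cases
      assume "v = p"
      then have "u = v" using uxv by simp
      then show ?thesis by simp
    next
      assume x: "x = p" "p < v"
      then have u: "u = p" using uxv by simp
      have "v \<in> \<gamma> x" using uxv by auto
      then have "v < q" using x by (simp add: \<gamma>_def)
      have "(A v - A u) *v f x - (F v - F u) = - ((A q - A v) *v (f p - f d))"
        using x u by (simp add: F_def matrix_vector_mult_diff_rdistrib matrix_vector_mult_diff_distrib)
      also have "norm \<dots> \<le> norm (A q - A v) * norm (f p - f d)"
        by (simp add: norm_matrix_vector_mult_le)
      also have "\<dots> \<le> k * norm (f p - f d)"
        using A[of v q] r(2)[of v q] \<open>v < q\<close> x q by (intro mult_right_mono) auto
      also have "\<dots> \<le> \<eta>" by (rule k)
      also have "e * V p \<le> e * V v"
        using x \<open>0 < e\<close> by (intro mult_left_mono monoD[OF \<open>mono V\<close>]) auto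
      then have "\<eta> \<le> H v - H u"
        using x u by (simp add: H_def)
      finally show ?thesis .
    next
      assume x: "p < x"
      have "u \<in> \<gamma> x" using uxv by auto
      then have "p < u" using x by (simp add: \<gamma>_def)
      then have "(A v - A u) *v f x - (F v - F u) = (A v - A u) *v (f x - f d)"
        using uxv by (simp add: F_def matrix_vector_mult_diff_rdistrib matrix_vector_mult_diff_distrib)
      also have "norm \<dots> \<le> norm (A v - A u) * norm (f x - f d)"
        by (rule norm_matrix_vector_mult_le)
      also have "\<dots> \<le> (V v - V u) * e"
        using uxv x A[of u v] f[of x] norm_ge_zero[of "A v - A u"] \<open>0 < e\<close>
      by (intro mult_mono norm_ge_zero) linarith+
      also have "\<dots> = H v - H u"
        using \<open>p < u\<close> uxv by (simp add: H_def algebra_simps)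
      finally show ?thesis .
    qed
  qed
  moreover have "gauge \<gamma>"
    using q by (auto simp: gauge_def \<gamma>_def)
  moreover have "H d - H p \<le> e * (V d + d) - e * (V p + p)"
    using \<open>p < d\<close> by (simp add: H_def \<eta>_def algebra_simps)
  ultimately show ?thesis
    unfolding RS_approximable_def by metis
qed

text \<open>Bisection reduces the claim to small intervals around a point p. These are cut at p:
  left continuity of f handles the left half, and the small variation of f on an open interval after
  p the right half.\<close>

lemma KS_integrable_BV:
  fixes A :: "real \<Rightarrow> real^'n^'m" and f :: "real \<Rightarrow> real^'n"
  assumes A: "\<And>u v. \<lbrakk>a \<le> u; u \<le> v\<rbrakk> \<Longrightarrow> norm (A v - A u) \<le> V v - V u" and "mono V"
    and f: "\<And>u v. \<lbrakk>a \<le> u; u \<le> v\<rbrakk> \<Longrightarrow> norm (f v - f u) \<le> W v - W u" and "mono W"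
    and lc: "\<And>t. a < t \<Longrightarrow> (f \<longlongrightarrow> f t) (at_left t)" and "a \<le> b"
  shows "\<exists>I. KS_has_integral (*v) A f I a b"
proof -
  have approx: "RS_approximable A f (\<lambda>t. e * (V t + t)) a b" if "e > 0" for e
  proof -
    define P where "P c d \<longleftrightarrow> a \<le> c \<and> c \<le> d \<longrightarrow> RS_approximable A f (\<lambda>t. e * (V t + t)) c d" for c d
    from \<open>a \<le> b\<close> have "P a b"
    proof (induction rule: Bolzano)
      case (trans c m d)
      then show ?case
        unfolding P_def by (meson RS_approximable_trans order.trans)
    next
      case (local p)
      obtain r where r: "r > 0" "\<And>u v. \<lbrakk>p < u; u \<le> v; v < p + r\<rbrakk> \<Longrightarrow> W v - W u \<le> e"
        using mono_small_variation_right[OF \<open>mono W\<close> \<open>e > 0\<close>] by metis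
      have "\<exists>l>0. \<forall>x. p - l < x \<and> x \<le> p \<and> a \<le> x \<longrightarrow> norm (f x - f p) \<le> e"
      proof (cases "a < p")
        case True
        from tendstoD[OF lc[OF this] \<open>e > 0\<close>]
        obtain k where "k < p" "\<And>x. k < x \<Longrightarrow> x < p \<Longrightarrow> dist (f x) (f p) < e"
          unfolding eventually_at_left_field by metis
        then show ?thesis
          using \<open>e > 0\<close> by (intro exI[of _ "p - k"]) (force simp: dist_norm order_le_less)
      next
        case False
        then have "norm (f x - f p) \<le> e" if "x \<le> p" "a \<le> x" for x
        proof -
          have "x = p" using that False by linarith
          then show ?thesis using \<open>e > 0\<close> by simp
        qed
        then show ?thesis
          by (intro exI[of _ 1]) auto
      qed
      then obtain l where l: "l > 0" "\<And>x. \<lbrakk>p - l < x; x \<le> p; a \<le> x\<rbrakk> \<Longrightarrow> norm (f x - f p) \<le> e"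
        by metis
      have "P c d" if cd: "c \<le> p \<and> p \<le> d \<and> d - c < min l r" for c d
        unfolding P_def
      proof
        assume ac: "a \<le> c \<and> c \<le> d"
        have left: "RS_approximable A f (\<lambda>t. e * (V t + t)) c p"
          using cd ac \<open>e > 0\<close> by (intro RS_approximable_left A l(2)) auto
        show "RS_approximable A f (\<lambda>t. e * (V t + t)) c d"
        proof (cases "p = d")
          case False
          have "norm (f x - f d) \<le> e" if "p < x" "x \<le> d" for x
            using f[of x d] r(2)[of x d] that cd ac by (simp add: norm_minus_commute)
          then have "RS_approximable A f (\<lambda>t. e * (V t + t)) p d"
            using cd ac \<open>e > 0\<close> False by (intro RS_approximable_right A \<open>mono V\<close>) auto
          then show ?thesis
            using left cd RS_approximable_trans by blast
        qed (use left in simp)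
      qed
      then show ?case
        using l(1) r(1) by (intro exI[of _ "min l r"]) auto
    qed
    then show ?thesis
      using \<open>a \<le> b\<close> by (simp add: P_def)
  qed
  \<comment> \<open>C is the growth of the budget V(t) + t over {a..b}; dividing e by C + 1 brings
    the total error below e, also if C = 0.\<close>
  define C where "C = V b + b - (V a + a)"
  have "C \<ge> 0"
    using \<open>a \<le> b\<close> monoD[OF \<open>mono V\<close> \<open>a \<le> b\<close>] by (simp add: C_def)
  show ?thesis
  proof (rule KS_integrable_Cauchy[OF _ \<open>a \<le> b\<close>])
    fix e :: real assume "e > 0"
    define e' where "e' = e / (C + 1)"
    have "e' > 0" "e' * C \<le> e"
      using \<open>e > 0\<close> \<open>C \<ge> 0\<close> by (auto simp: e'_def field_simps)
    obtain F H \<gamma> where F: "gauge \<gamma>"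
      "\<And>u x v. \<lbrakk>a \<le> u; u \<le> x; x \<le> v; v \<le> b; {u..v} \<subseteq> \<gamma> x\<rbrakk>
        \<Longrightarrow> norm ((A v - A u) *v f x - (F v - F u)) \<le> H v - H u"
      "H b - H a \<le> e' * (V b + b) - e' * (V a + a)"
      using approx[OF \<open>e' > 0\<close>] unfolding RS_approximable_def by metis
    have "norm (RS A f D - (F b - F a)) \<le> e" if "D tagged_division_of {a..b}" "\<gamma> fine D" for D
    proof -
      have "norm (RS A f D - (F b - F a)) \<le> H b - H a"
        using RS_telescope[OF that \<open>a \<le> b\<close>] F(2) by blast
      also have "\<dots> \<le> e' * C"
        using F(3) by (simp add: C_def algebra_simps)
      finally show ?thesis
        using \<open>e' * C \<le> e\<close> by simp
    qed
    then show "\<exists>I \<gamma>. gauge \<gamma> \<and>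
        (\<forall>D. D tagged_division_of {a..b} \<longrightarrow> \<gamma> fine D \<longrightarrow> norm (RS A f D - I) \<le> e)"
      using F(1) by blast
  qed
qed

section \<open>Total variation\<close>

lemma total_variation_ge_sum:
  assumes "D division_of {a..b}"
  shows "ereal (\<Sum>K\<in>D. norm (f (Sup K) - f (Inf K))) \<le> total_variation f a b"
  unfolding total_variation_def using assms by (intro SUP_upper) auto

lemma total_variation_ge_norm:
  assumes "a \<le> b"
  shows "ereal (norm (f b - f a)) \<le> total_variation f a b"
  using total_variation_ge_sum[of "{{a..b}}" a b f] division_of_self[of a b] assms by simp

text \<open>Any division of {a..u} can be extended by {u..v}, which is a new element because v lies
  beyond u.\<close>

lemma total_variation_add_norm:
  assumes "a \<le> u" "u < v"
    and fin: "total_variation f a u = ereal r" "total_variation f a v = ereal s"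
  shows "r + norm (f v - f u) \<le> s"
proof -
  have "ereal r \<le> ereal (s - norm (f v - f u))"
    unfolding fin(1)[symmetric] total_variation_def
  proof (rule SUP_least)
    fix D assume "D \<in> {D. D division_of {a..u}}"
    then have D: "D division_of {a..u}" by simp
    have "interior {a..u} \<inter> interior {u..v} = {}" by auto
    from division_disjoint_union[OF D _ this, of "{{u..v}}"]
    have Dv: "insert {u..v} D division_of {a..v}"
      using assms(1,2) division_of_self[of u v] by (simp add: ivl_disj_un_two_touch(4))
    have new: "{u..v} \<notin> D"
      using division_ofD(2)[OF D, of "{u..v}"] \<open>u < v\<close> by auto
    have "ereal (norm (f v - f u) + (\<Sum>K\<in>D. norm (f (Sup K) - f (Inf K)))) \<le> ereal s"
      using total_variation_ge_sum[OF Dv, of f] \<open>u < v\<close> new division_of_finite[OF D]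
      by (simp add: fin(2))
    then show "ereal (\<Sum>K\<in>D. norm (f (Sup K) - f (Inf K))) \<le> ereal (s - norm (f v - f u))"
      by simp
  qed
  then show ?thesis by simp
qed

text \<open>From here on a real monotone majorant V replaces the extended-real variation; its
  increments bound those of f and telescope.\<close>

lemma locally_bv_on_dominated:
  assumes bv: "locally_bv_on f s0"
  obtains V where "mono V" "\<And>u v. \<lbrakk>s0 \<le> u; u \<le> v\<rbrakk> \<Longrightarrow> norm (f v - f u) \<le> V v - V u"
    "\<And>t. s0 \<le> t \<Longrightarrow> V t - V s0 \<le> real_of_ereal (total_variation f s0 t)"
proof -
  \<comment> \<open>The variation function is continued by a constant to the left of s0, which makes
    V monotone on the whole line.\<close>
  define V where "V t = real_of_ereal (total_variation f s0 (max s0 t))" for t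
  have V: "total_variation f s0 t = ereal (V t)" "0 \<le> V t" if "s0 \<le> t" for t
  proof -
    have "0 \<le> total_variation f s0 t"
      using order.trans[OF _ total_variation_ge_norm[OF that, of f], of 0] by simp
    moreover have "total_variation f s0 t < \<infinity>"
      using bv that by (simp add: locally_bv_on_def)
    ultimately show "total_variation f s0 t = ereal (V t)" "0 \<le> V t"
      using that by (cases "total_variation f s0 t"; simp add: V_def)+
  qed
  have inc: "norm (f v - f u) \<le> V v - V u" if "s0 \<le> u" "u \<le> v" for u v
  proof (cases "u = v")
    case False
    then show ?thesis
      using total_variation_add_norm[of s0 u v f "V u" "V v"] V that by simp
  qed simp
  have "mono V"
  proof (rule monoI)
    fix u v :: real assume "u \<le> v"
    then have "max s0 u \<le> max s0 v" by simp
    then have "V (max s0 u) \<le> V (max s0 v)"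
      using inc[of "max s0 u" "max s0 v"] norm_ge_zero[of "f (max s0 v) - f (max s0 u)"] by linarith
    then show "V u \<le> V v"
      by (simp add: V_def)
  qed
  moreover have "V t - V s0 \<le> real_of_ereal (total_variation f s0 t)" if "s0 \<le> t" for t
    using V(1)[OF that] V(2)[of s0] by simp
  ultimately show thesis
    using that inc by blast
qed

lemma total_variation_le:
  assumes inc: "\<And>u v. \<lbrakk>a \<le> u; u \<le> v; v \<le> b\<rbrakk> \<Longrightarrow> norm (f v - f u) \<le> V v - V u" and "a \<le> b"
  shows "total_variation f a b \<le> ereal (V b - V a)"
  unfolding total_variation_def
proof (rule SUP_least)
  fix D assume "D \<in> {D. D division_of {a..b}}"
  then have D: "D division_of {a..b}" by simp
  have el: "\<exists>u v. K = {u..v} \<and> a \<le> u \<and> u \<le> v \<and> v \<le> b" if K_in: "K \<in> D" for K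
  proof -
    obtain u v where K: "K = {u..v}"
      using division_ofD(4)[OF D K_in] by auto
    moreover have "K \<noteq> {}" "K \<subseteq> {a..b}"
      using division_ofD(2,3)[OF D K_in] by auto
    ultimately show ?thesis by auto
  qed
  have inj: "inj_on (\<lambda>K. (Inf K, K)) D"
    by (auto simp: inj_on_def)
  \<comment> \<open>Tagging each interval with its left end makes the telescoping law for tagged
    divisions available.\<close>
  have tagged: "(\<lambda>K. (Inf K, K)) ` D tagged_division_of {a..b}"
  proof (rule tagged_division_ofI)
    show "finite ((\<lambda>K. (Inf K, K)) ` D)"
      using division_of_finite[OF D] by simp
    fix x K assume xK: "(x, K) \<in> (\<lambda>K. (Inf K, K)) ` D"
    then obtain u v where "K = {u..v}" "a \<le> u" "u \<le> v" "v \<le> b" using el by blast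
    with xK show "x \<in> K" "K \<subseteq> {a..b}" "\<exists>a b. K = cbox a b" by auto
  next
    fix x1 K1 x2 K2
    assume "(x1, K1) \<in> (\<lambda>K. (Inf K, K)) ` D" "(x2, K2) \<in> (\<lambda>K. (Inf K, K)) ` D"
      "(x1, K1) \<noteq> (x2, K2)"
    then show "interior K1 \<inter> interior K2 = {}"
      using division_ofD(5)[OF D, of K1 K2] by auto
  next
    have "{K. \<exists>x. (x, K) \<in> (\<lambda>K. (Inf K, K)) ` D} = D" by auto
    then show "\<Union> {K. \<exists>x. (x, K) \<in> (\<lambda>K. (Inf K, K)) ` D} = {a..b}"
      using division_ofD(6)[OF D] by simp
  qed
  have "(\<Sum>K\<in>D. norm (f (Sup K) - f (Inf K))) \<le> (\<Sum>K\<in>D. V (Sup K) - V (Inf K))"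
  proof (rule sum_mono)
    fix K assume "K \<in> D"
    then obtain u v where "K = {u..v}" "a \<le> u" "u \<le> v" "v \<le> b" using el by blast
    then show "norm (f (Sup K) - f (Inf K)) \<le> V (Sup K) - V (Inf K)"
      using inc by simp
  qed
  also have "\<dots> = V b - V a"
    using additive_tagged_division_1[OF \<open>a \<le> b\<close> tagged, of V] by (simp add: sum.reindex[OF inj])
  finally show "ereal (\<Sum>K\<in>D. norm (f (Sup K) - f (Inf K))) \<le> ereal (V b - V a)" by simp
qed

section \<open>Solutions and perturbed solutions\<close>

text \<open>An interval around p is always cut at p. A large jump of V there then sits at an
  endpoint of both pieces, and \<open>step\<close> constrains V only between the endpoints.\<close>

lemma small_variation_chain:
  fixes V :: "real \<Rightarrow> real"
  assumes "mono V" "a \<le> b"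
    and refl: "\<And>c. \<lbrakk>a \<le> c; c \<le> b\<rbrakk> \<Longrightarrow> P c c"
    and trans: "\<And>c m d. \<lbrakk>a \<le> c; c \<le> m; m \<le> d; d \<le> b; P c m; P m d\<rbrakk> \<Longrightarrow> P c d"
    and step: "\<And>c d. \<lbrakk>a \<le> c; c < d; d \<le> b;
      \<And>u v. \<lbrakk>c < u; u \<le> v; v < d\<rbrakk> \<Longrightarrow> V v - V u \<le> 1/2\<rbrakk> \<Longrightarrow> P c d"
  shows "P a b"
proof -
  have "a \<le> a \<and> b \<le> b \<longrightarrow> P a b"
    using \<open>a \<le> b\<close>
  proof (induction rule: Bolzano[where P = "\<lambda>c d. a \<le> c \<and> d \<le> b \<longrightarrow> P c d"])
    case (trans c m d)
    then show ?case
      by (meson assms(4) order.trans)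
  next
    case (local p)
    obtain r where r: "r > 0" "\<And>u v. \<lbrakk>p < u; u \<le> v; v < p + r\<rbrakk> \<Longrightarrow> V v - V u \<le> 1/2"
      using mono_small_variation_right[OF \<open>mono V\<close>, of "1/2" p] by auto
    obtain l where l: "l > 0" "\<And>u v. \<lbrakk>p - l < u; u \<le> v; v < p\<rbrakk> \<Longrightarrow> V v - V u \<le> 1/2"
      using mono_small_variation_left[OF \<open>mono V\<close>, of "1/2" p] by auto
    have "P c d" if cd: "c \<le> p \<and> p \<le> d \<and> d - c < min l r" "a \<le> c \<and> d \<le> b" for c d
    proof -
      have "P c p"
      proof (cases "c = p")
        case False
        then show ?thesis
          using cd by (intro step l(2)) auto
      qed (use refl local in simp)
      moreover have "P p d"
      proof (cases "p = d")
        case False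
        then show ?thesis
          using cd by (intro step r(2)) auto
      qed (use refl local in simp)
      ultimately show ?thesis
        using cd assms(4) by blast
    qed
    then show ?case
      using l(1) r(1) by (intro exI[of _ "min l r"]) auto
  qed
  then show ?thesis by simp
qed

text \<open>As z(c) = 0, the jump of A at c does not contribute, and as z is continuous from the left, the
  jump at d may be ignored. Only the oscillation of A on the open interval (c,d) matters, so that the
  Gronwall argument needs no more than a contraction factor 1/2.\<close>

lemma KS_perturbation_step:
  fixes A :: "real \<Rightarrow> real^'n^'n"
  assumes "c < d" and A: "\<And>u v. \<lbrakk>c \<le> u; u \<le> v; v \<le> d\<rbrakk> \<Longrightarrow> norm (A v - A u) \<le> V v - V u"
    and osc: "\<And>u v. \<lbrakk>c < u; u \<le> v; v < d\<rbrakk> \<Longrightarrow> V v - V u \<le> 1/2"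
    and z: "\<And>s. \<lbrakk>c \<le> s; s \<le> d\<rbrakk> \<Longrightarrow> KS_has_integral (*v) A z (z s - (Q s - Q c)) c s"
    and z0: "z c = 0" and bdd: "\<And>s. \<lbrakk>c \<le> s; s \<le> d\<rbrakk> \<Longrightarrow> norm (z s) \<le> B"
    and lim: "(z \<longlongrightarrow> z d) (at_left d)"
    and Q: "\<And>u v. \<lbrakk>c \<le> u; u \<le> v; v \<le> d\<rbrakk> \<Longrightarrow> norm (Q v - Q u) \<le> W v - W u"
  shows "norm (z d) \<le> 2 * (W d - W c)"
proof -
  \<comment> \<open>The bound B makes this supremum finite, without which it could not be absorbed
    below. The point d is left out because V may jump there; z(d) is recovered as a left
    limit.\<close>
  define S where "S = (SUP s\<in>{c..<d}. norm (z s))"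
  define w where "w = W d - W c"
  have bdd': "bdd_above ((\<lambda>s. norm (z s)) ` {c..<d})"
    using bdd by (intro bdd_aboveI2[of _ _ B]) auto
  have S: "norm (z s) \<le> S" if "c \<le> s" "s < d" for s
    unfolding S_def using that by (intro cSUP_upper bdd') auto
  have "0 \<le> S"
    using S[of c] \<open>c < d\<close> z0 by simp
  have Wmono: "W u \<le> W v" if "c \<le> u" "u \<le> v" "v \<le> d" for u v
    using order.trans[OF norm_ge_zero Q[OF that]] by simp
  have Vmono: "V u \<le> V v" if "c \<le> u" "u \<le> v" "v \<le> d" for u v
    using order.trans[OF norm_ge_zero A[OF that]] by simp
  have bound: "norm (z s) \<le> w + S / 2" if s: "c \<le> s" "s < d" for s
  proof (cases "s = c")
    case True
    then show ?thesis
      using z0 \<open>0 \<le> S\<close> Wmono[of c d] \<open>c < d\<close> by (simp add: w_def)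
  next
    case False
    then have "c < s" using s by simp
    \<comment> \<open>Intervals with tag c contribute nothing, as z(c) = 0, so H only must not
      decrease from c to v. By \<open>osc\<close>, V(s) - 1/2 is at most V(v) for c < v, so this
      value at c replaces a possible jump of V and leaves a total increment of S/2. The gauge keeps
      all intervals with later tags away from c.\<close>
    define H where "H t = S * (if t \<le> c then V s - 1/2 else V t)" for t
    define \<gamma> where "\<gamma> x = (if x \<le> c then UNIV else {c<..})" for x :: real
    have "norm (z s - (Q s - Q c)) \<le> H s - H c"
    proof (rule KS_has_integral_bound[OF z])
      show "gauge \<gamma>"
        by (auto simp: gauge_def \<gamma>_def)
      fix u x v assume uxv: "c \<le> u" "u \<le> x" "x \<le> v" "v \<le> s" "{u..v} \<subseteq> \<gamma> x"
      show "norm ((A v - A u) *v z x) \<le> H v - H u"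
      proof (cases "x = c")
        case True
        then have "u = c" using uxv by simp
        then have "H u \<le> H v"
          using \<open>0 \<le> S\<close> osc[of v s] uxv s by (auto simp: H_def intro!: mult_left_mono)
        then show ?thesis
          using True z0 by simp
      next
        case False
        then have "c < x" using uxv by simp
        moreover have "u \<in> \<gamma> x" using uxv by auto
        ultimately have "c < u" by (simp add: \<gamma>_def)
        have "norm ((A v - A u) *v z x) \<le> norm (A v - A u) * norm (z x)"
          by (rule norm_matrix_vector_mult_le)
        also have "\<dots> \<le> (V v - V u) * S"
          using uxv s A[of u v] S[of x] Vmono[of u v] by (intro mult_mono) auto
        also have "\<dots> = H v - H u"
          using \<open>c < u\<close> uxv by (simp add: H_def algebra_simps)
        finally show ?thesis .
      qed
    qed (use s in auto)
    also have "\<dots> = S / 2"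
      using \<open>c < s\<close> by (simp add: H_def algebra_simps)
    finally have "norm (z s - (Q s - Q c)) \<le> S / 2" .
    moreover have "norm (Q s - Q c) \<le> w"
      using Q[of c s] s Wmono[of s d] by (simp add: w_def)
    ultimately show ?thesis
      using norm_triangle_sub[of "z s" "Q s - Q c"] by linarith
  qed
  \<comment> \<open>Absorbing S/2 gives S \<le> 2w, the origin of the factor 2 in all later
    bounds.\<close>
  have "S \<le> w + S / 2"
    unfolding S_def using \<open>c < d\<close> bound by (intro cSUP_least) (auto simp: S_def)
  then have "norm (z s) \<le> 2 * w" if "c \<le> s" "s < d" for s
    using S[OF that] by linarith
  then have "eventually (\<lambda>s. norm (z s) \<le> 2 * w) (at_left d)"
    using \<open>c < d\<close> by (auto simp: eventually_at_left_field intro!: exI[of _ c])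
  then have "norm (z d) \<le> 2 * w"
    by (intro tendsto_upperbound[OF tendsto_norm[OF lim]]) auto
  then show ?thesis by (simp add: w_def)
qed

section \<open>Solutions of the unperturbed equation: regularity and forward uniqueness\<close>

locale generalized_linear_ode =
  fixes A :: "real \<Rightarrow> real^'n^'n" and V :: "real \<Rightarrow> real"
  assumes mono_V: "mono V"
    and A_le_V: "\<And>u v. \<lbrakk>0 \<le> u; u \<le> v\<rbrakk> \<Longrightarrow> norm (A v - A u) \<le> V v - V u"
    and A_left: "\<And>t. 0 < t \<Longrightarrow> (A \<longlongrightarrow> A t) (at_left t)"
begin

definition solution_from :: "real \<Rightarrow> (real \<Rightarrow> real^'n) \<Rightarrow> bool" where
  "solution_from a f \<longleftrightarrow> (\<forall>t\<ge>a. KS_has_integral (*v) A f (f t - f a) a t)"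

lemma solution_fromD: "solution_from a f \<Longrightarrow> a \<le> t \<Longrightarrow> KS_has_integral (*v) A f (f t - f a) a t"
  by (simp add: solution_from_def)

lemma solution_from_mono:
  assumes "solution_from a f" "a \<le> c"
  shows "solution_from c f"
  unfolding solution_from_def
proof (intro allI impI)
  fix t assume "c \<le> t"
  then have "KS_has_integral (*v) A f ((f t - f a) - (f c - f a)) c t"
    using assms by (intro KS_has_integral_remainder[of _ _ _ a] solution_fromD) auto
  then show "KS_has_integral (*v) A f (f t - f c) c t" by simp
qed

lemma solution_from_diff:
  assumes "solution_from a f" "solution_from a g"
  shows "solution_from a (\<lambda>t. f t - g t)"
  unfolding solution_from_def
proof (intro allI impI)
  fix t assume "a \<le> t"
  then have "KS_has_integral (*v) A (\<lambda>t. f t - g t) ((f t - f a) - (g t - g a)) a t"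
    using assms by (intro KS_has_integral_diff solution_fromD)
  then show "KS_has_integral (*v) A (\<lambda>t. f t - g t) (f t - g t - (f a - g a)) a t"
    by (simp add: algebra_simps)
qed

text \<open>Nothing but integrability is known of f at this point. Near p the increment of f differs
  by less than 1 from that of A applied to f(p), which gives a bound in terms of f(p) alone;
  bisection then acts as compactness.\<close>

lemma solution_bounded:
  assumes sol: "solution_from a f" and "0 \<le> a" "a \<le> b"
  obtains M where "\<And>t. \<lbrakk>a \<le> t; t \<le> b\<rbrakk> \<Longrightarrow> norm (f t) \<le> M"
proof -
  obtain \<gamma> where \<gamma>: "gauge \<gamma>"
    "\<And>u x v. \<lbrakk>a \<le> u; u \<le> x; x \<le> v; v \<le> b; {u..v} \<subseteq> \<gamma> x\<rbrakk>
      \<Longrightarrow> norm ((A v - A u) *v f x - (f v - f u)) < 1"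
    using KS_solution_local[OF solution_fromD[OF sol] \<open>a \<le> b\<close> zero_less_one] by metis
  have near: "norm (f t) \<le> norm (f p) + (V b - V a) * norm (f p) + 1"
    if pt: "a \<le> p" "p \<le> b" "a \<le> t" "t \<le> b" and sub: "{min p t..max p t} \<subseteq> \<gamma> p" for p t
  proof -
    define u v where "u = min p t" and "v = max p t"
    have uv: "a \<le> u" "u \<le> p" "p \<le> v" "v \<le> b" "u \<le> v"
      using pt by (auto simp: u_def v_def)
    have 1: "norm ((A v - A u) *v f p - (f v - f u)) < 1"
      using \<gamma>(2)[of u p v] uv sub by (simp add: u_def v_def)
    have "norm ((A v - A u) *v f p) \<le> norm (A v - A u) * norm (f p)"
      by (rule norm_matrix_vector_mult_le)
    also have "\<dots> \<le> (V b - V a) * norm (f p)"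
      using A_le_V[of u v] uv \<open>0 \<le> a\<close> monoD[OF mono_V, of v b] monoD[OF mono_V, of a u]
      by (intro mult_right_mono) auto
    finally have 2: "norm ((A v - A u) *v f p) \<le> (V b - V a) * norm (f p)" .
    have "norm (f v - f u) = norm (f t - f p)"
      by (cases "p \<le> t") (auto simp: u_def v_def min_def max_def norm_minus_commute)
    moreover have "norm (f v - f u) \<le> norm ((A v - A u) *v f p) + norm ((A v - A u) *v f p - (f v - f u))"
      by (metis norm_minus_commute norm_triangle_sub)
    ultimately show ?thesis
      using 1 2 norm_triangle_sub[of "f t" "f p"] by linarith
  qed
  have "a \<le> a \<and> b \<le> b \<longrightarrow> (\<exists>M. \<forall>t. a \<le> t \<and> t \<le> b \<longrightarrow> norm (f t) \<le> M)"
    using \<open>a \<le> b\<close>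
  proof (induction rule: Bolzano[where P = "\<lambda>c d. a \<le> c \<and> d \<le> b \<longrightarrow> (\<exists>M. \<forall>t. c \<le> t \<and> t \<le> d \<longrightarrow> norm (f t) \<le> M)"])
    case (trans c m d)
    show ?case
    proof
      assume "a \<le> c \<and> d \<le> b"
      then obtain M N where "\<forall>t. c \<le> t \<and> t \<le> m \<longrightarrow> norm (f t) \<le> M"
        "\<forall>t. m \<le> t \<and> t \<le> d \<longrightarrow> norm (f t) \<le> N"
        using trans by (meson order.trans)
      then have "\<forall>t. c \<le> t \<and> t \<le> d \<longrightarrow> norm (f t) \<le> max M N"
        by (metis le_max_iff_disj linear)
      then show "\<exists>M. \<forall>t. c \<le> t \<and> t \<le> d \<longrightarrow> norm (f t) \<le> M" ..
    qed
  next
    case (local p)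
    obtain r where r: "r > 0" "ball p r \<subseteq> \<gamma> p"
      using \<gamma>(1) by (meson gauge_def openE)
    have "norm (f t) \<le> norm (f p) + (V b - V a) * norm (f p) + 1"
      if "c \<le> p \<and> p \<le> d \<and> d - c < r" "a \<le> c \<and> d \<le> b" "c \<le> t \<and> t \<le> d" for c d t
    proof (rule near)
      have "{min p t..max p t} \<subseteq> ball p r"
        using that by (auto simp: dist_real_def)
      then show "{min p t..max p t} \<subseteq> \<gamma> p" using r by blast
    qed (use that in auto)
    then show ?case
      using r(1) by (intro exI[of _ r]) blast
  qed
  then show thesis using that by blast
qed

text \<open>With the tag at the right end t, the increment f(t) - f(s) is close to (A(t) - A(s))
  f(t), and A is continuous from the left.\<close>

lemma solution_left_continuous:
  assumes sol: "solution_from a f" and "0 \<le> a" "a < t"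
  shows "(f \<longlongrightarrow> f t) (at_left t)"
proof (rule tendstoI)
  fix e :: real assume "e > 0"
  then have e: "e / 2 > 0" by simp
  obtain \<gamma> where \<gamma>: "gauge \<gamma>"
    "\<And>u x v. \<lbrakk>a \<le> u; u \<le> x; x \<le> v; v \<le> t; {u..v} \<subseteq> \<gamma> x\<rbrakk>
      \<Longrightarrow> norm ((A v - A u) *v f x - (f v - f u)) < e / 2"
    using KS_solution_local[OF solution_fromD[OF sol] less_imp_le[OF \<open>a < t\<close>] e] by metis
  obtain r where r: "r > 0" "ball t r \<subseteq> \<gamma> t"
    using \<gamma>(1) by (meson gauge_def openE)
  have "((\<lambda>s. norm (A t - A s) * norm (f t)) \<longlongrightarrow> norm (A t - A t) * norm (f t)) (at_left t)"
    using \<open>0 \<le> a\<close> \<open>a < t\<close> by (intro tendsto_intros A_left) auto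
  then have "eventually (\<lambda>s. norm (A t - A s) * norm (f t) < e / 2) (at_left t)"
    by (rule order_tendstoD(2)) (use e in simp)
  moreover have "eventually (\<lambda>s. max a (t - r) < s \<and> s < t) (at_left t)"
    using \<open>a < t\<close> r(1) unfolding eventually_at_left_field by (intro exI[of _ "max a (t - r)"]) auto
  ultimately show "eventually (\<lambda>s. dist (f s) (f t) < e) (at_left t)"
  proof eventually_elim
    case (elim s)
    have "{s..t} \<subseteq> ball t r"
      using elim by (auto simp: dist_real_def)
    then have "norm ((A t - A s) *v f t - (f t - f s)) < e / 2"
      using r elim by (intro \<gamma>(2)) auto
    moreover have "norm ((A t - A s) *v f t) < e / 2"
      using elim norm_matrix_vector_mult_le[of "A t - A s" "f t"] by simp
    ultimately have "norm (f t - f s) < e"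
      using norm_triangle_ineq4[of "(A t - A s) *v f t" "(A t - A s) *v f t - (f t - f s)"] by simp
    then show ?case
      by (simp add: dist_norm norm_minus_commute)
  qed
qed

lemma solution_increment:
  assumes sol: "solution_from a f" and "0 \<le> a" "a \<le> u" "u \<le> v"
    and M: "\<And>t. \<lbrakk>u \<le> t; t \<le> v\<rbrakk> \<Longrightarrow> norm (f t) \<le> M"
  shows "norm (f v - f u) \<le> M * V v - M * V u"
proof (rule KS_has_integral_bound[OF _ \<open>u \<le> v\<close> gauge_UNIV])
  show "KS_has_integral (*v) A f (f v - f u) u v"
    using assms by (intro solution_fromD[OF solution_from_mono[OF sol]])
  fix s x t assume "u \<le> s" "s \<le> x" "x \<le> t" "t \<le> v"
  then have "norm (A t - A s) * norm (f x) \<le> (V t - V s) * M"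
    using A_le_V[of s t] M[of x] assms(2,3) monoD[OF mono_V, of s t]
    by (intro mult_mono) auto
  then show "norm ((A t - A s) *v f x) \<le> M * V t - M * V s"
    using norm_matrix_vector_mult_le[of "A t - A s" "f x"] by (simp add: algebra_simps)
qed

lemma solution_locally_bv:
  assumes sol: "solution_from a f" and "0 \<le> a"
  shows "locally_bv_on f a"
  unfolding locally_bv_on_def
proof (intro allI impI)
  fix t assume "a \<le> t"
  obtain M where M: "\<And>s. \<lbrakk>a \<le> s; s \<le> t\<rbrakk> \<Longrightarrow> norm (f s) \<le> M"
    using solution_bounded[OF sol \<open>0 \<le> a\<close> \<open>a \<le> t\<close>] by metis
  have "total_variation f a t \<le> ereal (M * V t - M * V a)"
    using M by (intro total_variation_le[OF solution_increment[OF sol \<open>0 \<le> a\<close>] \<open>a \<le> t\<close>]) auto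
  then show "total_variation f a t < \<infinity>"
    by (rule le_less_trans) simp
qed

text \<open>Forward uniqueness: with Q = 0 the perturbation step carries a zero of f from c to d,
  and the chain of small steps carries it from a to b.\<close>

lemma solution_eq_0:
  assumes sol: "solution_from a f" and "0 \<le> a" "a \<le> b" "f a = 0"
  shows "f b = 0"
proof -
  obtain M where M: "\<And>t. \<lbrakk>a \<le> t; t \<le> b\<rbrakk> \<Longrightarrow> norm (f t) \<le> M"
    using solution_bounded[OF sol \<open>0 \<le> a\<close> \<open>a \<le> b\<close>] by metis
  have "f a = 0 \<longrightarrow> f b = 0"
  proof (rule small_variation_chain[OF mono_V \<open>a \<le> b\<close>, where P = "\<lambda>c d. f c = 0 \<longrightarrow> f d = 0"])
    fix c d assume cd: "a \<le> c" "c < d" "d \<le> b"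
      and osc: "\<And>u v. \<lbrakk>c < u; u \<le> v; v < d\<rbrakk> \<Longrightarrow> V v - V u \<le> 1/2"
    show "f c = 0 \<longrightarrow> f d = 0"
    proof
      assume fc: "f c = 0"
      have "norm (f d) \<le> 2 * (0 - 0)"
      proof (rule KS_perturbation_step[OF \<open>c < d\<close>, where z = f and A = A and V = V and B = M
            and Q = "\<lambda>_. 0" and W = "\<lambda>_. 0"])
        show "KS_has_integral (*v) A f (f s - (0 - 0)) c s" if "c \<le> s" "s \<le> d" for s
          using solution_fromD[OF solution_from_mono[OF sol \<open>a \<le> c\<close>] \<open>c \<le> s\<close>] fc by simp
        show "(f \<longlongrightarrow> f d) (at_left d)"
          using cd \<open>0 \<le> a\<close> by (intro solution_left_continuous[OF sol]) auto
      qed (use cd fc \<open>0 \<le> a\<close> A_le_V osc M in auto)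
      then show "f d = 0" by simp
    qed
  qed auto
  then show ?thesis using assms by simp
qed

end

section \<open>Comparison of perturbed solutions with the transition matrix\<close>

locale transition_matrix = generalized_linear_ode A V for A :: "real \<Rightarrow> real^'n^'n" and V +
  fixes U :: "real \<Rightarrow> real \<Rightarrow> real^'n^'n"
  assumes transition: "is_transition_matrix A U"
begin

lemma U_refl:
  assumes "0 \<le> s"
  shows "U s s *v x = x"
proof -
  have "KS_has_integral (**) A (\<lambda>r. U r s) (U s s - mat 1) s s"
    using transition assms by (simp add: is_transition_matrix_def)
  then have "(U s s - mat 1) *v x = 0"
    by (intro KS_has_integral_refl_eq_0[OF KS_has_integral_matrix_vector]) auto
  then show ?thesis
    by (simp add: matrix_vector_mult_diff_rdistrib)
qed

lemma solution_U:
  assumes "0 \<le> s"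
  shows "solution_from s (\<lambda>t. U t s *v x)"
  unfolding solution_from_def
proof (intro allI impI)
  fix t assume "s \<le> t"
  then have "KS_has_integral (**) A (\<lambda>r. U r s) (U t s - mat 1) s t"
    using transition assms by (simp add: is_transition_matrix_def)
  from KS_has_integral_matrix_vector[OF this \<open>s \<le> t\<close>, of x]
  show "KS_has_integral (*v) A (\<lambda>t. U t s *v x) (U t s *v x - U s s *v x) s t"
    by (simp add: U_refl assms matrix_vector_mult_diff_rdistrib)
qed

text \<open>Both sides are solutions in t from s on, with the same value at t = s, so their
  difference vanishes by \<open>solution_eq_0\<close>.\<close>

lemma U_cocycle:
  assumes "0 \<le> r" "r \<le> s" "s \<le> t"
  shows "U t s *v (U s r *v x) = U t r *v x"
proof -
  have "solution_from s (\<lambda>t. U t s *v (U s r *v x) - U t r *v x)"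
    using assms by (intro solution_from_diff solution_U solution_from_mono[OF solution_U]) auto
  from solution_eq_0[OF this _ \<open>s \<le> t\<close>] show ?thesis
    using assms by (simp add: U_refl)
qed

text \<open>By linearity y - U(.,c) y(c) satisfies the same perturbed equation as y and vanishes at
  c. The bounds B and M only make a supremum finite and leave no trace in the conclusion.\<close>

lemma perturbed_solution_step:
  assumes "0 \<le> s0" "s0 \<le> c" "c < d"
    and osc: "\<And>u v. \<lbrakk>c < u; u \<le> v; v < d\<rbrakk> \<Longrightarrow> V v - V u \<le> 1/2"
    and y: "\<And>s. s0 \<le> s \<Longrightarrow> KS_has_integral (*v) A y (y s - Q s - (y s0 - Q s0)) s0 s"
    and B: "\<And>s. \<lbrakk>s0 \<le> s; s \<le> d\<rbrakk> \<Longrightarrow> norm (y s) \<le> B"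
    and y_left: "(y \<longlongrightarrow> y d) (at_left d)"
    and Q: "\<And>u v. \<lbrakk>s0 \<le> u; u \<le> v\<rbrakk> \<Longrightarrow> norm (Q v - Q u) \<le> W v - W u"
  shows "norm (y d - U d c *v y c) \<le> 2 * (W d - W c)"
proof -
  have "0 \<le> c" using assms by simp
  obtain M where M: "\<And>t. \<lbrakk>c \<le> t; t \<le> d\<rbrakk> \<Longrightarrow> norm (U t c *v y c) \<le> M"
    using solution_bounded[OF solution_U \<open>0 \<le> c\<close> less_imp_le[OF \<open>c < d\<close>]] \<open>0 \<le> c\<close> by metis
  show ?thesis
  proof (rule KS_perturbation_step[OF \<open>c < d\<close>, where V = V and Q = Q and W = W and A = A
        and z = "\<lambda>t. y t - U t c *v y c" and B = "B + M"])
    fix s assume s: "c \<le> s" "s \<le> d"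
    show "norm (y s - U s c *v y c) \<le> B + M"
      using B[of s] M[of s] s assms(2) norm_triangle_ineq4[of "y s" "U s c *v y c"] by simp
    have "KS_has_integral (*v) A y ((y s - Q s - (y s0 - Q s0)) - (y c - Q c - (y s0 - Q s0))) c s"
      using s assms by (intro KS_has_integral_remainder[OF y y]) auto
    from KS_has_integral_diff[OF this solution_fromD[OF solution_U[where x = "y c"]] \<open>c \<le> s\<close>]
    show "KS_has_integral (*v) A (\<lambda>t. y t - U t c *v y c) (y s - U s c *v y c - (Q s - Q c)) c s"
      using \<open>0 \<le> c\<close> s by (simp add: U_refl algebra_simps)
  next
    show "((\<lambda>t. y t - U t c *v y c) \<longlongrightarrow> y d - U d c *v y c) (at_left d)"
      by (intro tendsto_diff y_left solution_left_continuous[OF solution_U[OF \<open>0 \<le> c\<close>] \<open>0 \<le> c\<close> \<open>c < d\<close>])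
  qed (use assms A_le_V U_refl \<open>0 \<le> c\<close> in auto)
qed

text \<open>K bounds U(t,s) for the fixed final time t, so each step costs the factor K once, and
  the increments of W telescope whatever the number of steps.\<close>

lemma perturbed_solution_estimate:
  assumes "0 \<le> s0" "s0 \<le> t"
    and y: "\<And>s. s0 \<le> s \<Longrightarrow> KS_has_integral (*v) A y (y s - Q s - (y s0 - Q s0)) s0 s"
    and B: "\<And>s. \<lbrakk>s0 \<le> s; s \<le> t\<rbrakk> \<Longrightarrow> norm (y s) \<le> B"
    and y_left: "\<And>s. s0 < s \<Longrightarrow> (y \<longlongrightarrow> y s) (at_left s)"
    and Q: "\<And>u v. \<lbrakk>s0 \<le> u; u \<le> v\<rbrakk> \<Longrightarrow> norm (Q v - Q u) \<le> W v - W u"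
    and K: "\<And>s x. \<lbrakk>s0 \<le> s; s \<le> t\<rbrakk> \<Longrightarrow> norm (U t s *v x) \<le> K * norm x" and "0 \<le> K"
  shows "norm (y t - U t s0 *v y s0) \<le> 2 * K * (W t - W s0)"
proof -
  define g where "g s = U t s *v y s" for s
  have "norm (g t - g s0) \<le> 2 * K * (W t - W s0)"
  proof (rule small_variation_chain[OF mono_V \<open>s0 \<le> t\<close>,
        where P = "\<lambda>c d. norm (g d - g c) \<le> 2 * K * (W d - W c)"])
    fix c m d assume "norm (g m - g c) \<le> 2 * K * (W m - W c)" "norm (g d - g m) \<le> 2 * K * (W d - W m)"
    then have "norm ((g m - g c) + (g d - g m)) \<le> 2 * K * (W m - W c) + 2 * K * (W d - W m)"
      by (rule norm_triangle_mono)
    then show "norm (g d - g c) \<le> 2 * K * (W d - W c)"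
      by (simp add: algebra_simps)
  next
    fix c d assume cd: "s0 \<le> c" "c < d" "d \<le> t"
      and osc: "\<And>u v. \<lbrakk>c < u; u \<le> v; v < d\<rbrakk> \<Longrightarrow> V v - V u \<le> 1/2"
    have "g d - g c = U t d *v (y d - U d c *v y c)"
      using cd \<open>0 \<le> s0\<close> by (simp add: g_def matrix_vector_mult_diff_distrib U_cocycle)
    also have "norm \<dots> \<le> K * norm (y d - U d c *v y c)"
      using cd by (intro K) auto
    also have "\<dots> \<le> K * (2 * (W d - W c))"
      using cd \<open>0 \<le> s0\<close> \<open>0 \<le> K\<close>
      by (intro mult_left_mono perturbed_solution_step[of s0 c d y Q B W] osc y B y_left Q) auto
    finally show "norm (g d - g c) \<le> 2 * K * (W d - W c)" by (simp only: mult_ac)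
  qed simp
  then show ?thesis
    using assms(1,2) by (simp add: g_def U_refl)
qed

lemma perturbation_bound:
  assumes "0 \<le> s0" "s0 \<le> t" and bv: "locally_bv_on y s0" and left: "\<forall>t>s0. continuous (at_left t) y"
    and var: "(SUP t\<in>{s0..}. total_variation (\<lambda>s. y s - KS_integral (*v) A y s0 s) s0 t) < ereal \<delta>"
    and K: "\<And>s x. \<lbrakk>s0 \<le> s; s \<le> t\<rbrakk> \<Longrightarrow> norm (U t s *v x) \<le> K * norm x" and "0 \<le> K"
  shows "norm (y t - U t s0 *v y s0) \<le> 2 * K * \<delta>"
proof -
  define Q where "Q s = y s - KS_integral (*v) A y s0 s" for s
  obtain Y where Y: "mono Y" "\<And>u v. \<lbrakk>s0 \<le> u; u \<le> v\<rbrakk> \<Longrightarrow> norm (y v - y u) \<le> Y v - Y u"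
    using locally_bv_on_dominated[OF bv] by metis
  have y_left: "(y \<longlongrightarrow> y s) (at_left s)" if "s0 < s" for s
    using left that by (simp add: continuous_within)
  have int: "KS_has_integral (*v) A y (y s - Q s) s0 s" if s: "s0 \<le> s" for s
  proof -
    \<comment> \<open>Only existence turns the description \<open>KS_integral\<close> into a true
      integral, so that y - Q can be used in the perturbed equation.\<close>
    have "\<exists>I. KS_has_integral (*v) A y I s0 s"
      using \<open>0 \<le> s0\<close> by (intro KS_integrable_BV[of s0 A V y Y s] A_le_V mono_V Y y_left s) auto
    then show ?thesis
      using KS_integral_eq[OF _ s] by (auto simp: Q_def)
  qed
  have Qs0: "y s0 - Q s0 = 0"
    by (rule KS_has_integral_refl_eq_0[OF int[OF order.refl]])
  have tv: "total_variation Q s0 s < ereal \<delta>" if "s0 \<le> s" for s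
  proof -
    have "(SUP t\<in>{s0..}. total_variation Q s0 t) < ereal \<delta>"
      using var by (simp add: Q_def[abs_def])
    moreover have "total_variation Q s0 s \<le> (SUP t\<in>{s0..}. total_variation Q s0 t)"
      using that by (intro SUP_upper) simp
    ultimately show ?thesis
      by (rule order.strict_trans1[rotated])
  qed
  have "total_variation Q s0 s < \<infinity>" if "s0 \<le> s" for s
    using tv[OF that] by auto
  then have "locally_bv_on Q s0"
    by (simp add: locally_bv_on_def)
  then obtain W where W: "\<And>u v. \<lbrakk>s0 \<le> u; u \<le> v\<rbrakk> \<Longrightarrow> norm (Q v - Q u) \<le> W v - W u"
    "\<And>s. s0 \<le> s \<Longrightarrow> W s - W s0 \<le> real_of_ereal (total_variation Q s0 s)"
    using locally_bv_on_dominated by metis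
  have "norm (y s) \<le> norm (y s0) + (Y t - Y s0)" if "s0 \<le> s" "s \<le> t" for s
    using Y(2)[of s0 s] monoD[OF Y(1), of s t] that norm_triangle_sub[of "y s" "y s0"] by simp
  then have "norm (y t - U t s0 *v y s0) \<le> 2 * K * (W t - W s0)"
    using int Qs0 K \<open>0 \<le> K\<close> y_left
    by (intro perturbed_solution_estimate[OF \<open>0 \<le> s0\<close> \<open>s0 \<le> t\<close>, where Q = Q] W(1)) auto
  also have "W t - W s0 \<le> \<delta>"
  proof -
    have "0 \<le> total_variation Q s0 t"
      using order.trans[OF _ total_variation_ge_norm[OF \<open>s0 \<le> t\<close>, of Q], of 0] by simp
    then have "real_of_ereal (total_variation Q s0 t) \<le> \<delta>"
      using tv[OF \<open>s0 \<le> t\<close>] by (cases "total_variation Q s0 t") auto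
    then show ?thesis using W(2)[OF \<open>s0 \<le> t\<close>] by simp
  qed
  then have "2 * K * (W t - W s0) \<le> 2 * K * \<delta>"
    using \<open>0 \<le> K\<close> by (intro mult_left_mono) auto
  finally show ?thesis .
qed

section \<open>From exponential decay to stability and attraction\<close>

lemma norm_U_le: "mat_norm (U t s) \<le> C \<Longrightarrow> norm (U t s *v x) \<le> C * norm x"
  unfolding mat_norm_def
  by (rule order.trans[OF onorm[OF matrix_vector_mul_bounded_linear]]) (intro mult_right_mono, auto)

lemma exponential_imp_var_asymptotically_stable:
  assumes "\<alpha> > 0" "K > 0"
    and U: "\<And>s t. \<lbrakk>0 \<le> s; s \<le> t\<rbrakk> \<Longrightarrow> mat_norm (U t s) \<le> K * exp (- \<alpha> * (t - s))"
  shows "var_asymptotically_stable A"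
proof -
  have UK: "norm (U t s *v x) \<le> K * norm x" if "0 \<le> s" "s \<le> t" for s t x
  proof (rule norm_U_le)
    have "exp (- \<alpha> * (t - s)) \<le> 1"
      using that \<open>\<alpha> > 0\<close> by simp
    then have "K * exp (- \<alpha> * (t - s)) \<le> K"
      using \<open>K > 0\<close> by simp
    then show "mat_norm (U t s) \<le> K"
      using U[OF that] by linarith
  qed
  have est: "norm (y t) \<le> norm (U t s0 *v y s0) + 2 * K * \<delta>"
    if "0 \<le> s0" "s0 \<le> t" "locally_bv_on y s0" "\<forall>t>s0. continuous (at_left t) y"
      "(SUP t\<in>{s0..}. total_variation (\<lambda>s. y s - KS_integral (*v) A y s0 s) s0 t) < ereal \<delta>"
    for y s0 t \<delta>
  proof -
    have "norm (y t - U t s0 *v y s0) \<le> 2 * K * \<delta>"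
      using \<open>K > 0\<close> \<open>0 \<le> s0\<close> by (intro perturbation_bound[OF that] UK) auto
    then show ?thesis
      using norm_triangle_sub[of "y t" "U t s0 *v y s0"] by linarith
  qed
  have "var_stable A"
    unfolding var_stable_def
  proof (intro allI impI)
    fix \<epsilon> :: real assume "\<epsilon> > 0"
    \<comment> \<open>The initial value contributes at most K \<delta> and the perturbation 2 K
      \<delta>, together 3/4 of \<epsilon>.\<close>
    define \<delta> where "\<delta> = \<epsilon> / (4 * K)"
    have \<delta>: "\<delta> > 0" "4 * (K * \<delta>) = \<epsilon>"
      using \<open>\<epsilon> > 0\<close> \<open>K > 0\<close> by (simp_all add: \<delta>_def)
    show "\<exists>\<delta>>0. \<forall>s0\<ge>0. \<forall>y :: real \<Rightarrow> real^'n.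
        locally_bv_on y s0 \<and> (\<forall>t>s0. continuous (at_left t) y) \<and> norm (y s0) < \<delta> \<and>
        (SUP t\<in>{s0..}. total_variation (\<lambda>s. y s - KS_integral (*v) A y s0 s) s0 t) < ereal \<delta>
        \<longrightarrow> (\<forall>t\<ge>s0. norm (y t) < \<epsilon>)"
    proof (intro exI[of _ \<delta>] conjI \<delta>(1) allI impI)
      fix s0 t :: real and y :: "real \<Rightarrow> real^'n"
      assume that: "0 \<le> s0" "s0 \<le> t" "locally_bv_on y s0 \<and> (\<forall>t>s0. continuous (at_left t) y) \<and> norm (y s0) < \<delta> \<and>
        (SUP t\<in>{s0..}. total_variation (\<lambda>s. y s - KS_integral (*v) A y s0 s) s0 t) < ereal \<delta>"
      have "norm (y t) \<le> norm (U t s0 *v y s0) + 2 * K * \<delta>"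
        using that by (intro est) auto
      also have "norm (U t s0 *v y s0) \<le> K * norm (y s0)"
        using that by (intro UK)
      also have "K * norm (y s0) \<le> K * \<delta>"
        using that \<open>K > 0\<close> by simp
      finally show "norm (y t) < \<epsilon>"
        using \<delta> \<open>\<epsilon> > 0\<close> by simp
    qed
  qed
  moreover have "var_attracting A"
    unfolding var_attracting_def
  proof (rule exI[of _ 1], intro conjI zero_less_one allI impI)
    fix \<epsilon> :: real assume "\<epsilon> > 0"
    \<comment> \<open>The perturbation may use 2 K \<gamma> = \<epsilon>/4. T is chosen such that K
      exp(-\<alpha> T) \<le> \<epsilon>/2, which leaves at most \<epsilon>/2 for initial values of
      norm below 1; the maximum with 0 covers \<epsilon> > 2 K.\<close>
    define \<gamma> where "\<gamma> = \<epsilon> / (8 * K)"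
    define T where "T = max 0 (ln (2 * K / \<epsilon>) / \<alpha>)"
    have \<gamma>: "\<gamma> > 0" "8 * (K * \<gamma>) = \<epsilon>"
      using \<open>\<epsilon> > 0\<close> \<open>K > 0\<close> by (simp_all add: \<gamma>_def)
    have "T \<ge> 0" by (simp add: T_def)
    show "\<exists>T\<ge>0. \<exists>\<gamma>>0. \<forall>s0\<ge>0. \<forall>y :: real \<Rightarrow> real^'n.
        locally_bv_on y s0 \<and> (\<forall>t>s0. continuous (at_left t) y) \<and> norm (y s0) < 1 \<and>
        (SUP t\<in>{s0..}. total_variation (\<lambda>s. y s - KS_integral (*v) A y s0 s) s0 t) < ereal \<gamma>
        \<longrightarrow> (\<forall>t\<ge>s0 + T. norm (y t) < \<epsilon>)"
    proof (rule exI[of _ T], intro conjI \<open>T \<ge> 0\<close>, rule exI[of _ \<gamma>], intro conjI \<gamma>(1) allI impI)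
      fix s0 t :: real and y :: "real \<Rightarrow> real^'n"
      assume that: "0 \<le> s0" "s0 + T \<le> t" "locally_bv_on y s0 \<and> (\<forall>t>s0. continuous (at_left t) y) \<and> norm (y s0) < 1 \<and>
        (SUP t\<in>{s0..}. total_variation (\<lambda>s. y s - KS_integral (*v) A y s0 s) s0 t) < ereal \<gamma>"
      have "s0 \<le> t" using that \<open>T \<ge> 0\<close> by simp
      have "ln (2 * K / \<epsilon>) \<le> \<alpha> * T"
        using \<open>\<alpha> > 0\<close> by (simp add: T_def pos_divide_le_eq[symmetric] mult.commute[of \<alpha>])
      also have "\<dots> \<le> \<alpha> * (t - s0)"
        using \<open>\<alpha> > 0\<close> that by simp
      finally have "exp (ln (2 * K / \<epsilon>)) \<le> exp (\<alpha> * (t - s0))"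
        by simp
      then have "2 * K \<le> exp (\<alpha> * (t - s0)) * \<epsilon>"
        using \<open>\<epsilon> > 0\<close> \<open>K > 0\<close> by (simp add: pos_divide_le_eq)
      then have "K / exp (\<alpha> * (t - s0)) \<le> \<epsilon> / 2"
        by (simp add: pos_divide_le_eq mult.commute)
      then have small: "K * exp (- \<alpha> * (t - s0)) \<le> \<epsilon> / 2"
        by (simp add: exp_minus flip: divide_inverse)
      have "norm (y t) \<le> norm (U t s0 *v y s0) + 2 * K * \<gamma>"
        using that \<open>s0 \<le> t\<close> by (intro est) auto
      also have "norm (U t s0 *v y s0) \<le> \<epsilon> / 2 * norm (y s0)"
        using order.trans[OF U[OF \<open>0 \<le> s0\<close> \<open>s0 \<le> t\<close>] small] by (rule norm_U_le)
      also have "\<epsilon> / 2 * norm (y s0) \<le> \<epsilon> / 2 * 1"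
        using that \<open>\<epsilon> > 0\<close> by (intro mult_left_mono) auto
      finally show "norm (y t) < \<epsilon>"
        using \<gamma> \<open>\<epsilon> > 0\<close> by simp
    qed
  qed
  ultimately show ?thesis
    by (simp add: var_asymptotically_stable_def)
qed

section \<open>From stability and attraction to exponential decay\<close>

lemma solution_unperturbed:
  fixes x :: "real^'n"
  assumes "0 \<le> s" "0 < \<delta>"
  defines "y \<equiv> \<lambda>t. U t s *v x"
  shows "locally_bv_on y s" "\<forall>t>s. continuous (at_left t) y" "y s = x"
    "(SUP t\<in>{s..}. total_variation (\<lambda>r. y r - KS_integral (*v) A y s r) s t) < ereal \<delta>"
proof -
  have sol: "solution_from s y"
    unfolding y_def by (rule solution_U[OF \<open>0 \<le> s\<close>])
  show "locally_bv_on y s"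
    by (rule solution_locally_bv[OF sol \<open>0 \<le> s\<close>])
  show "\<forall>t>s. continuous (at_left t) y"
    using solution_left_continuous[OF sol \<open>0 \<le> s\<close>] by (simp add: continuous_within)
  show "y s = x"
    by (simp add: y_def U_refl \<open>0 \<le> s\<close>)
  have const: "y r - KS_integral (*v) A y s r = y s" if "s \<le> r" for r
    using KS_integral_eq[OF solution_fromD[OF sol that] that] by simp
  have "total_variation (\<lambda>r. y r - KS_integral (*v) A y s r) s t \<le> ereal (0 - 0)" if "s \<le> t" for t
    using that const by (intro total_variation_le[where V = "\<lambda>_. 0"]) auto
  then have "(SUP t\<in>{s..}. total_variation (\<lambda>r. y r - KS_integral (*v) A y s r) s t) \<le> 0"
    by (intro SUP_least) (simp add: zero_ereal_def)
  also have "0 < ereal \<delta>" using \<open>0 < \<delta>\<close> by simp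
  finally show "(SUP t\<in>{s..}. total_variation (\<lambda>r. y r - KS_integral (*v) A y s r) s t) < ereal \<delta>" .
qed

text \<open>A nonzero x is scaled to norm \<delta>/2, strictly inside the ball; this is where the
  factor 2 comes from.\<close>

lemma mat_norm_le_of_ball:
  fixes M :: "real^'n^'n"
  assumes "\<delta> > 0" and M: "\<And>x. norm x < \<delta> \<Longrightarrow> norm (M *v x) \<le> c"
  shows "mat_norm M \<le> 2 * c / \<delta>"
  unfolding mat_norm_def
proof (rule onorm_le)
  fix x :: "real^'n"
  show "norm (M *v x) \<le> 2 * c / \<delta> * norm x"
  proof (cases "x = 0")
    case False
    define k where "k = \<delta> / (2 * norm x)"
    have "k > 0" using False \<open>\<delta> > 0\<close> by (simp add: k_def)
    have "norm (M *v (k *\<^sub>R x)) \<le> c"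
      using False \<open>\<delta> > 0\<close> by (intro M) (simp add: k_def)
    then have "k * norm (M *v x) \<le> c"
      using \<open>k > 0\<close> by (simp add: matrix_vector_mult_scaleR)
    then have "norm (M *v x) \<le> c / k"
      using \<open>k > 0\<close> by (simp add: pos_le_divide_eq mult.commute)
    then show ?thesis
      by (simp add: k_def mult_ac)
  qed simp
qed

lemma mat_norm_U_le_mult:
  assumes "0 \<le> r" "r \<le> s" "s \<le> t"
  shows "mat_norm (U t r) \<le> mat_norm (U t s) * mat_norm (U s r)"
proof -
  have "(\<lambda>x. U t r *v x) = (\<lambda>x. U t s *v x) \<circ> (\<lambda>x. U s r *v x)"
    using U_cocycle[OF assms] by (simp add: fun_eq_iff)
  then show ?thesis
    unfolding mat_norm_def by (simp add: onorm_compose)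
qed

lemma mat_norm_nonneg: "0 \<le> mat_norm M"
  unfolding mat_norm_def by (rule onorm_pos_le) simp

lemma var_asymptotically_stable_imp_exponential:
  assumes "var_asymptotically_stable A"
  shows "\<exists>\<alpha>>0. \<exists>K>0. \<forall>s0\<ge>0. \<forall>t\<ge>s0. mat_norm (U t s0) \<le> K * exp (- \<alpha> * (t - s0))"
proof -
  have "var_stable A" "var_attracting A"
    using assms by (simp_all add: var_asymptotically_stable_def)
  from \<open>var_stable A\<close> obtain \<delta> where "\<delta> > 0" and stable: "\<forall>s0\<ge>0. \<forall>y :: real \<Rightarrow> real^'n.
        locally_bv_on y s0 \<and> (\<forall>t>s0. continuous (at_left t) y) \<and> norm (y s0) < \<delta> \<and>
        (SUP t\<in>{s0..}. total_variation (\<lambda>s. y s - KS_integral (*v) A y s0 s) s0 t) < ereal \<delta>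
        \<longrightarrow> (\<forall>t\<ge>s0. norm (y t) < 1)"
    unfolding var_stable_def using zero_less_one by blast
  \<comment> \<open>Stability is needed for \<epsilon> = 1 only; linearity turns a bound on a ball
    into a bound on the operator norm.\<close>
  define C where "C = 2 / \<delta>"
  have C: "mat_norm (U t s) \<le> C" if "0 \<le> s" "s \<le> t" for s t
  proof -
    have "norm (U t s *v x) \<le> 1" if "norm x < \<delta>" for x
      using stable[rule_format, of s "\<lambda>t. U t s *v x" t] that \<open>0 \<le> s\<close> \<open>s \<le> t\<close>
        solution_unperturbed[OF \<open>0 \<le> s\<close> \<open>\<delta> > 0\<close>, of x] by simp
    then show ?thesis
      using mat_norm_le_of_ball[OF \<open>\<delta> > 0\<close>, of "U t s" 1] by (simp add: C_def)
  qed
  have "C > 0" using \<open>\<delta> > 0\<close> by (simp add: C_def)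
  from \<open>var_attracting A\<close> obtain \<delta>0 where "\<delta>0 > 0" and attr: "\<forall>\<epsilon>>0. \<exists>T\<ge>0. \<exists>\<gamma>>0. \<forall>s0\<ge>0. \<forall>y :: real \<Rightarrow> real^'n.
        locally_bv_on y s0 \<and> (\<forall>t>s0. continuous (at_left t) y) \<and> norm (y s0) < \<delta>0 \<and>
        (SUP t\<in>{s0..}. total_variation (\<lambda>s. y s - KS_integral (*v) A y s0 s) s0 t) < ereal \<gamma>
        \<longrightarrow> (\<forall>t\<ge>s0 + T. norm (y t) < \<epsilon>)"
    unfolding var_attracting_def by blast
  \<comment> \<open>\<open>mat_norm_le_of_ball\<close> turns the bound \<open>\<delta>0 / 4\<close>
    on the ball of radius \<open>\<delta>0\<close> into the operator bound 1/2. T' does not depend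
    on the initial time, so the halving is uniform.\<close>
  have "\<delta>0 / 4 > 0" using \<open>\<delta>0 > 0\<close> by simp
  from attr[rule_format, OF this] obtain T' \<gamma> where "T' \<ge> 0" "\<gamma> > 0" and
    small: "\<forall>s0\<ge>0. \<forall>y :: real \<Rightarrow> real^'n.
        locally_bv_on y s0 \<and> (\<forall>t>s0. continuous (at_left t) y) \<and> norm (y s0) < \<delta>0 \<and>
        (SUP t\<in>{s0..}. total_variation (\<lambda>s. y s - KS_integral (*v) A y s0 s) s0 t) < ereal \<gamma>
        \<longrightarrow> (\<forall>t\<ge>s0 + T'. norm (y t) < \<delta>0 / 4)"
    by blast
  \<comment> \<open>T' may be 0, whereas T is a positive step length by which times are
    divided.\<close>
  define T where "T = T' + 1"
  have "T > 0" using \<open>T' \<ge> 0\<close> by (simp add: T_def)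
  have half: "mat_norm (U (s + T) s) \<le> 1 / 2" if "0 \<le> s" for s
  proof -
    have "norm (U (s + T) s *v x) \<le> \<delta>0 / 4" if "norm x < \<delta>0" for x
      using small[rule_format, of s "\<lambda>t. U t s *v x" "s + T"] that \<open>0 \<le> s\<close>
        solution_unperturbed[OF \<open>0 \<le> s\<close> \<open>\<gamma> > 0\<close>, of x] by (simp add: T_def)
    then show ?thesis
      using mat_norm_le_of_ball[OF \<open>\<delta>0 > 0\<close>, of "U (s + T) s" "\<delta>0 / 4"] \<open>\<delta>0 > 0\<close> by simp
  qed
  have pow: "mat_norm (U t s) \<le> C * (1 / 2) ^ n" if "0 \<le> s" "s + n * T \<le> t" for n s t
    using that
  proof (induction n arbitrary: s)
    case 0
    then show ?case using C by simp
  next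
    case (Suc n)
    \<comment> \<open>The piece of length T is split off at the initial time, with t fixed; whatever
      remains after n pieces is paid for by C.\<close>
    have le: "s + T + n * T \<le> t"
      using Suc.prems by (simp add: algebra_simps)
    moreover have "0 \<le> n * T"
      using \<open>T > 0\<close> by simp
    ultimately have "s + T \<le> t" by linarith
    have "mat_norm (U t s) \<le> mat_norm (U t (s + T)) * mat_norm (U (s + T) s)"
      using \<open>T > 0\<close> \<open>s + T \<le> t\<close> Suc.prems by (intro mat_norm_U_le_mult) auto
    also have "\<dots> \<le> (C * (1 / 2) ^ n) * (1 / 2)"
      using Suc.IH[of "s + T"] le Suc.prems \<open>T > 0\<close> \<open>C > 0\<close>
      by (intro mult_mono half mat_norm_nonneg) auto
    finally show ?case by simp
  qed
  \<comment> \<open>One halving per time T is the rate ln 2 / T. Rounding (t - s)/T down to n loses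
    at most one halving, hence the constant 2 C.\<close>
  define \<alpha> where "\<alpha> = ln 2 / T"
  have "mat_norm (U t s) \<le> 2 * C * exp (- \<alpha> * (t - s))" if "0 \<le> s" "s \<le> t" for s t
  proof -
    define n where "n = nat \<lfloor>(t - s) / T\<rfloor>"
    have "0 \<le> (t - s) / T" using that \<open>T > 0\<close> by simp
    then have n: "real n \<le> (t - s) / T" "(t - s) / T \<le> real n + 1"
      unfolding n_def by linarith+
    then have "mat_norm (U t s) \<le> C * (1 / 2) ^ n"
      using that \<open>T > 0\<close> by (intro pow) (auto simp: field_simps)
    also have "(1 / 2) ^ n = exp (- (ln 2 * real n))"
      using exp_of_nat_mult[of n "- ln (2::real)"] by (simp add: exp_minus mult.commute)
    also have "\<dots> \<le> exp (ln 2 - ln 2 * ((t - s) / T))"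
      using mult_left_mono[OF n(2), of "ln 2"] by (simp add: algebra_simps)
    also have "\<dots> = 2 * exp (- \<alpha> * (t - s))"
      by (simp add: exp_diff exp_minus \<alpha>_def field_simps)
    finally show ?thesis using \<open>C > 0\<close> by simp
  qed
  moreover have "\<alpha> > 0" "2 * C > 0"
    using \<open>T > 0\<close> \<open>C > 0\<close> by (simp_all add: \<alpha>_def)
  ultimately show ?thesis by blast
qed

end

theorem theorem5p8:
  fixes A :: "real \<Rightarrow> real^'n^'n" and U :: "real \<Rightarrow> real \<Rightarrow> real^'n^'n"
  assumes "locally_bv_on A 0"
    and "\<forall>t>0. continuous (at_left t) A"
    and "\<forall>t>0. invertible (mat 1 - (A t - Lim (at_left t) A))"
    and "\<forall>t\<ge>0. invertible (mat 1 + (Lim (at_right t) A - A t))"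
    and "is_transition_matrix A U"
  shows "var_asymptotically_stable A \<longleftrightarrow>
    (\<exists>\<alpha>>0. \<exists>K>0. \<forall>s0\<ge>0. \<forall>t\<ge>s0. mat_norm (U t s0) \<le> K * exp (- \<alpha> * (t - s0)))"
proof -
  obtain V where V: "mono V" "\<And>u v. \<lbrakk>0 \<le> u; u \<le> v\<rbrakk> \<Longrightarrow> norm (A v - A u) \<le> V v - V u"
    using locally_bv_on_dominated[OF assms(1)] by metis
  interpret transition_matrix A V U
    using V assms(2,5) by unfold_locales (auto simp: continuous_within)
  show ?thesis
    using exponential_imp_var_asymptotically_stable var_asymptotically_stable_imp_exponential by metis
qed

end
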